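(* Let $\mathbf c$ be a total cost functional that is nondecreasing in the stage component and satisfies the limit condition for each oracle. Then there is a Turing incomplete c.e. set $D$ such that $\emptyset'\models^D\mathbf c^D$.
   Context: $\emptyset'$ denotes the halting problem. A cost functional is a Turing functional $\mathbf c^Z(x,t)$ such that for each oracle $Z\subseteq\mathbb N$, $\mathbf c^Z$ is either partial, or is a cost function relative to $Z$, i.e. a (total) $Z$-computable function $\mathbb N\times\mathbb N\to\{q\in\mathbb Q:q\ge0\}$. It is total if $\mathbf c^Z$ is total for each oracle $Z$. A total cost functional is nondecreasing in the stage component if for each $Z$ and all $x,s$: $\mathbf c^Z(x,s)=0$ for $x>s$, and $\mathbf c^Z(x,s)\le\mathbf c^Z(x,s+1)$. It satisfies the limit condition for each oracle if for every $Z$, $\lim_x\liminf_s\mathbf c^Z(x,s)=0$. For $A\le_TZ'$, a $Z$-computable approximation of $A$ is a $Z$-computable sequence of finite sets $\langle A_s\rangle_{s\in\mathbb N}$ with $\lim_sA_s(x)=A(x)$ for each $x$. We write $A\models^Z\mathbf c^Z$ if there is a $Z$-computable approximation $\langle A_s\rangle$ of $A$ such that $\sum_{s>0}\mathbf c^Z_s(A_s)<\infty$, where $\mathbf c^Z_s(A_s)=\mathbf c^Z(x,s)$ for the least $x$ with $A_{s-1}(x)\neq A_s(x)$ provided $x<s$, and $\mathbf c^Z_s(A_s)=0$ if there is no such $x<s$. A c.e. set $D$ is Turing incomplete if $\emptyset'\not\le_TD$. *)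

theory Defs
  imports Complex_Main "HOL-Library.Nat_Bijection" "HOL-Library.Extended_Real" "HOL-Library.Liminf_Limsup"
begin

section \<open>Computation relative to an oracle\<close>

text \<open>
  Turing functionals are given by programs for the partial recursive functions relative to an
  oracle. All functions are unary; several arguments or results are combined by the Cantor pairing
  function \<^const>\<open>prod_encode\<close>. The basic functions are zero, successor, the two projections of the
  pairing function and the characteristic function of the oracle; they are closed under pairing,
  composition, primitive recursion and unbounded search. The identity is \<open>PPair PFst PSnd\<close>.
\<close>

datatype prog =
    PZero
  | PSucc
  | PFst
  | PSnd
  | POracle
  | PPair prog prog
  | PComp prog prog
  | PRec prog prog
  | PMin prog

text \<open>
  \<open>computes Z p x y\<close>: the program \<open>p\<close> with oracle \<open>Z\<close> halts on input \<open>x\<close> with output \<open>y\<close>.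
  In \<open>cMin\<close>, all values of \<open>p\<close> below the first zero have to be defined.
\<close>

inductive computes :: "nat set \<Rightarrow> prog \<Rightarrow> nat \<Rightarrow> nat \<Rightarrow> bool" for Z :: "nat set" where
  cZero: "computes Z PZero x 0"
| cSucc: "computes Z PSucc x (Suc x)"
| cFst: "computes Z PFst (prod_encode (x, y)) x"
| cSnd: "computes Z PSnd (prod_encode (x, y)) y"
| cOracle: "computes Z POracle x (if x \<in> Z then 1 else 0)"
| cPair: "computes Z p x y \<Longrightarrow> computes Z q x z \<Longrightarrow> computes Z (PPair p q) x (prod_encode (y, z))"
| cComp: "computes Z q x y \<Longrightarrow> computes Z p y z \<Longrightarrow> computes Z (PComp p q) x z"
| cRec_0: "computes Z p x y \<Longrightarrow> computes Z (PRec p q) (prod_encode (x, 0)) y"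
| cRec_Suc: "computes Z (PRec p q) (prod_encode (x, n)) y \<Longrightarrow>
    computes Z q (prod_encode (x, prod_encode (n, y))) z \<Longrightarrow>
    computes Z (PRec p q) (prod_encode (x, Suc n)) z"
| cMin: "computes Z p (prod_encode (x, n)) 0 \<Longrightarrow>
    \<forall>m<n. \<exists>k. computes Z p (prod_encode (x, m)) (Suc k) \<Longrightarrow>
    computes Z (PMin p) x n"

inductive_cases computes_elims:
  "computes Z PZero x y" "computes Z PSucc x y" "computes Z PFst x y" "computes Z PSnd x y"
  "computes Z POracle x y" "computes Z (PPair p q) x y" "computes Z (PComp p q) x y"
inductive_cases computes_PRecE: "computes Z (PRec p q) x y"
inductive_cases computes_PMinE: "computes Z (PMin p) x y"

lemma computes_det: "computes Z p x y \<Longrightarrow> computes Z p x y' \<Longrightarrow> y = y'"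
proof (induction arbitrary: y' rule: computes.induct)
  case (cPair p x y q z)
  from cPair.prems show ?case by (rule computes_elims) (metis cPair.IH)
next
  case (cComp q x y p z)
  from cComp.prems show ?case by (rule computes_elims) (metis cComp.IH)
next
  case (cRec_0 p x y q)
  from cRec_0.prems show ?case by (rule computes_PRecE) (auto intro: cRec_0.IH)
next
  case (cRec_Suc p q x n y z)
  from cRec_Suc.prems show ?case
    by (rule computes_PRecE) (auto dest: cRec_Suc.IH(1) intro: cRec_Suc.IH(2))
next
  case (cMin p x n)
  from cMin.prems have n': "computes Z p (prod_encode (x, y')) 0"
    "\<forall>m<y'. \<exists>k. computes Z p (prod_encode (x, m)) (Suc k)"
    by (auto elim: computes_PMinE)
  show ?case
  proof (rule linorder_cases[of n y'])
    assume "n < y'"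
    then obtain k where "computes Z p (prod_encode (x, n)) (Suc k)" using n' by blast
    from cMin.IH(1)[OF this] show ?thesis by simp
  next
    assume "y' < n"
    then obtain k where "\<And>z. computes Z p (prod_encode (x, y')) z \<Longrightarrow> Suc k = z"
      using cMin.IH(2) by blast
    from this[OF n'(1)] show ?thesis by simp
  qed
qed (auto elim: computes_elims)

definition computable_in :: "nat set \<Rightarrow> (nat \<Rightarrow> nat) \<Rightarrow> bool" where
  "computable_in Z f \<longleftrightarrow> (\<exists>p. \<forall>x. computes Z p x (f x))"

definition turing_le :: "nat set \<Rightarrow> nat set \<Rightarrow> bool" (infix \<open>\<le>\<^sub>T\<close> 50) where
  "A \<le>\<^sub>T Z \<longleftrightarrow> computable_in Z (\<lambda>x. if x \<in> A then 1 else 0)"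

definition ce :: "nat set \<Rightarrow> bool" where
  "ce A \<longleftrightarrow> (\<exists>p. A = {x. \<exists>y. computes {} p x y})"

text \<open>An explicit Goedel numbering of programs.\<close>

primrec prog_code :: "prog \<Rightarrow> nat" where
  "prog_code PZero = prod_encode (0, 0)"
| "prog_code PSucc = prod_encode (1, 0)"
| "prog_code PFst = prod_encode (2, 0)"
| "prog_code PSnd = prod_encode (3, 0)"
| "prog_code POracle = prod_encode (4, 0)"
| "prog_code (PPair p q) = prod_encode (5, prod_encode (prog_code p, prog_code q))"
| "prog_code (PComp p q) = prod_encode (6, prod_encode (prog_code p, prog_code q))"
| "prog_code (PRec p q) = prod_encode (7, prod_encode (prog_code p, prog_code q))"
| "prog_code (PMin p) = prod_encode (8, prog_code p)"

lemma inj_prog_code: "inj prog_code"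
proof (rule injI)
  show "prog_code p = prog_code q \<Longrightarrow> p = q" for p q
    by (induction p arbitrary: q; case_tac q) auto
qed

text \<open>Numbers that do not code a program are treated as indices of the nowhere defined function.\<close>

definition halting_problem :: "nat set" where
  "halting_problem = {e. \<exists>p y. e = prog_code p \<and> computes {} p e y}"


section \<open>Cost functionals\<close>

text \<open>Every nonnegative rational is of the form \<open>rat_of_code n\<close>.\<close>

definition rat_of_code :: "nat \<Rightarrow> rat" where
  "rat_of_code n = (case prod_decode n of (a, b) \<Rightarrow> of_nat a / of_nat (Suc b))"

definition cost_function :: "nat set \<Rightarrow> (nat \<Rightarrow> nat \<Rightarrow> rat) \<Rightarrow> bool" where
  "cost_function Z f \<longleftrightarrow>
    (\<exists>g. computable_in Z g \<and> (\<forall>x t. f x t = rat_of_code (g (prod_encode (x, t)))))"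

text \<open>
  One program has to work for all oracles. The value \<^const>\<open>None\<close> means that the computation diverges.
  As outputs are read as codes of nonnegative rationals, for each oracle the functional is either
  partial or a cost function relative to that oracle, see \<open>cost_functional_cases\<close>.
\<close>

definition cost_functional :: "(nat set \<Rightarrow> nat \<Rightarrow> nat \<Rightarrow> rat option) \<Rightarrow> bool" where
  "cost_functional c \<longleftrightarrow> (\<exists>p. \<forall>Z x t q.
    c Z x t = Some q \<longleftrightarrow> (\<exists>n. computes Z p (prod_encode (x, t)) n \<and> q = rat_of_code n))"

definition total_functional :: "(nat set \<Rightarrow> nat \<Rightarrow> nat \<Rightarrow> rat option) \<Rightarrow> bool" where
  "total_functional c \<longleftrightarrow> (\<forall>Z x t. c Z x t \<noteq> None)"

text \<open>The function computed with oracle \<open>Z\<close>; only meaningful if the functional is total at \<open>Z\<close>.\<close>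

definition cost_at :: "(nat set \<Rightarrow> nat \<Rightarrow> nat \<Rightarrow> rat option) \<Rightarrow> nat set \<Rightarrow> nat \<Rightarrow> nat \<Rightarrow> rat" where
  "cost_at c Z x t = the (c Z x t)"

lemma rat_of_code_nonneg: "0 \<le> rat_of_code n"
  by (simp add: rat_of_code_def split: prod.split)

lemma rat_of_code_surj:
  assumes "0 \<le> q"
  shows "\<exists>n. q = rat_of_code n"
proof -
  obtain a b where q: "q = Fract a b" "b > 0" by (cases q) auto
  with assms have "a \<ge> 0" by (simp add: zero_le_Fract_iff)
  with q have "q = rat_of_code (prod_encode (nat a, nat b - 1))"
    by (simp add: rat_of_code_def Fract_of_int_quotient)
  then show ?thesis ..
qed

lemma cost_functional_cases:
  assumes "cost_functional c"
  shows "(\<exists>x t. c Z x t = None) \<or> cost_function Z (cost_at c Z)"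
proof (cases "\<exists>x t. c Z x t = None")
  case total: False
  from assms obtain p where p: "\<And>x t q. c Z x t = Some q \<longleftrightarrow>
      (\<exists>n. computes Z p (prod_encode (x, t)) n \<and> q = rat_of_code n)"
    unfolding cost_functional_def by blast
  have "\<exists>n. computes Z p m n" for m
    using total p by (metis not_None_eq prod_decode_inverse surj_pair)
  then obtain g where g: "\<And>m. computes Z p m (g m)" by metis
  then have "computable_in Z g" unfolding computable_in_def by blast
  moreover have "cost_at c Z x t = rat_of_code (g (prod_encode (x, t)))" for x t
    using p g unfolding cost_at_def by (metis option.sel)
  ultimately show ?thesis
    unfolding cost_function_def by blast
qed simp

definition nondecreasing_in_stage :: "(nat set \<Rightarrow> nat \<Rightarrow> nat \<Rightarrow> rat option) \<Rightarrow> bool" where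
  "nondecreasing_in_stage c \<longleftrightarrow> (\<forall>Z x s.
    (x > s \<longrightarrow> cost_at c Z x s = 0) \<and> cost_at c Z x s \<le> cost_at c Z x (Suc s))"

text \<open>The inner lower limit is taken in the extended reals, as it may be infinite for some \<open>x\<close>.\<close>

definition limit_condition :: "(nat set \<Rightarrow> nat \<Rightarrow> nat \<Rightarrow> rat option) \<Rightarrow> bool" where
  "limit_condition c \<longleftrightarrow> (\<forall>Z.
    (\<lambda>x. liminf (\<lambda>s. ereal (real_of_rat (cost_at c Z x s)))) \<longlonglongrightarrow> 0)"


section \<open>Obeying a cost function\<close>

text \<open>
  Sequences of finite sets are computable in the sense of strong (canonical) indices. By the limit
  lemma, an approximation relative to \<open>Z\<close> exists only for sets computable in the jump of \<open>Z\<close>.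
\<close>

definition approximation :: "nat set \<Rightarrow> nat set \<Rightarrow> (nat \<Rightarrow> nat set) \<Rightarrow> bool" where
  "approximation Z A As \<longleftrightarrow>
    (\<forall>s. finite (As s)) \<and> computable_in Z (\<lambda>s. set_encode (As s)) \<and>
    (\<forall>x. \<forall>\<^sub>F s in sequentially. x \<in> As s \<longleftrightarrow> x \<in> A)"

text \<open>The cost of the changes at stage \<open>s > 0\<close>.\<close>

definition stage_cost :: "(nat \<Rightarrow> nat \<Rightarrow> rat) \<Rightarrow> (nat \<Rightarrow> nat set) \<Rightarrow> nat \<Rightarrow> rat" where
  "stage_cost f As s =
    (if \<exists>x<s. (x \<in> As (s - 1)) \<noteq> (x \<in> As s)
     then f (LEAST x. (x \<in> As (s - 1)) \<noteq> (x \<in> As s)) s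
     else 0)"

definition obeys :: "nat set \<Rightarrow> nat set \<Rightarrow> (nat \<Rightarrow> nat \<Rightarrow> rat) \<Rightarrow> bool" where
  "obeys Z A f \<longleftrightarrow> (\<exists>As. approximation Z A As \<and>
    summable (\<lambda>s. real_of_rat (stage_cost f As (Suc s))))"

end

theory Submission
  imports Defs "HOL-Library.Sublist"
begin

text \<open>
  At stage \<open>s\<close> of the construction an entry \<open>s\<close> is pushed on a stack, and when \<open>n\<close> enters the halting
  problem, entries are popped beforehand down to height \<open>n\<close>, unless the popping is stopped by an entry
  that carries a label of threshold at most \<open>n\<close>. The set \<open>D\<close> consists of the stages that are
  eventually popped. So the stack at stage \<open>s\<close> is the current complement of \<open>D\<close>, and as long as an
  entry stays on the stack, \<open>D\<close> does not change below it.

  A label with index \<open>i\<close> and threshold \<open>p\<close> is attached to the entry \<open>s\<close> when the \<open>i\<close>-th functional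
  with the current oracle yields 0 at a fresh witness and all values \<open>c(x, t)\<close> with \<open>x \<ge> p\<close> that
  have converged so far are at most \<open>2\<close> to the power \<open>-i\<close>; the witness is then put into a c.e. set
  \<open>A\<close>. A label can only be injured by numbers below its threshold, that is, finitely often. Since by
  the limit condition some threshold suits \<open>i\<close>, the functional does not compute \<open>A\<close> from \<open>D\<close>, while
  \<open>A\<close> is many-one reducible to the halting problem.

  The stages outside \<open>D\<close> provide a \<open>D\<close>-computable approximation of the halting problem, where one
  waits at step \<open>t\<close> for the costs at step \<open>t + 1\<close> to converge. If \<open>n \<le> t\<close> is the least change between
  two of these stages, then the popping due to \<open>n\<close> was stopped by a label of threshold at most \<open>n\<close>,
  which is never popped. Hence the cost is at most \<open>2\<close> to the power \<open>-i\<close>. Labels that stay forever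
  have distinct indices, so the total cost is finite.
\<close>

section \<open>Computable functions on encoded types\<close>

class encodable =
  fixes enc :: "'a \<Rightarrow> nat"

instantiation nat :: encodable
begin
definition enc_nat_def [simp]: "enc (n :: nat) = n"
instance ..
end

instantiation bool :: encodable
begin
definition enc_bool_def [simp]: "enc b = (if b then 1 else 0 :: nat)"
instance ..
end

instantiation prod :: (encodable, encodable) encodable
begin
definition enc_prod_def [simp]: "enc v = prod_encode (enc (fst v), enc (snd v))"
instance ..
end

instantiation list :: (encodable) encodable
begin
primrec enc_list :: "'a list \<Rightarrow> nat" where
  "enc_list [] = 0"
| "enc_list (x # xs) = Suc (prod_encode (enc x, enc_list xs))"
instance ..
end

instantiation option :: (encodable) encodable
begin
definition enc_option_def [simp]: "enc v = (case v of None \<Rightarrow> 0 | Some x \<Rightarrow> Suc (enc x))"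
instance ..
end

instantiation prog :: encodable
begin
definition enc_prog_def [simp]: "enc p = prog_code p"
instance ..
end

definition cmp :: "nat set \<Rightarrow> ('a::encodable \<Rightarrow> 'b::encodable) \<Rightarrow> bool" where
  "cmp Z f \<longleftrightarrow> (\<exists>p. \<forall>x. computes Z p (enc x) (enc (f x)))"

named_theorems cmp_intros

lemma computes_PFst: "computes Z PFst n (fst (prod_decode n))"
  using cFst[of Z "fst (prod_decode n)" "snd (prod_decode n)"] by simp

lemma computes_PSnd: "computes Z PSnd n (snd (prod_decode n))"
  using cSnd[of Z "fst (prod_decode n)" "snd (prod_decode n)"] by simp

lemma computes_identity: "computes Z (PPair PFst PSnd) n n"
  using cPair[OF computes_PFst computes_PSnd, of Z n] by simp

primrec const_prog :: "nat \<Rightarrow> prog" where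
  "const_prog 0 = PZero"
| "const_prog (Suc n) = PComp PSucc (const_prog n)"

lemma computes_const_prog: "computes Z (const_prog n) x n"
  by (induction n) (auto intro: computes.intros)

lemma cmp_id [cmp_intros]: "cmp Z (\<lambda>x. x)"
  unfolding cmp_def using computes_identity by blast

lemma cmp_const [cmp_intros]: "cmp Z (\<lambda>x. c)"
  unfolding cmp_def using computes_const_prog by blast

lemma cmp_comp: "cmp Z f \<Longrightarrow> cmp Z g \<Longrightarrow> cmp Z (\<lambda>x. f (g x))"
  unfolding cmp_def using cComp by meson

text \<open>As \<open>enc\<close> is the identity on numbers, a function into a datatype may be
  built by arithmetic on codes at type \<open>nat\<close> and then read back.\<close>

lemma cmp_encode: "cmp Z (\<lambda>x. enc (f x)) \<longleftrightarrow> cmp Z f"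
  unfolding cmp_def by simp

lemma cmp_enc [cmp_intros]: "cmp Z f \<Longrightarrow> cmp Z (\<lambda>x. enc (f x))"
  by (simp only: cmp_encode)

lemma cmp_prod_encode [cmp_intros]:
  "cmp Z f \<Longrightarrow> cmp Z g \<Longrightarrow> cmp Z (\<lambda>x. prod_encode (f x, g x))"
  unfolding cmp_def using cPair by fastforce

lemma cmp_fst_prod_decode [cmp_intros]: "cmp Z f \<Longrightarrow> cmp Z (\<lambda>x. fst (prod_decode (f x)))"
  unfolding cmp_def using cComp computes_PFst by (metis enc_nat_def)

lemma cmp_snd_prod_decode [cmp_intros]: "cmp Z f \<Longrightarrow> cmp Z (\<lambda>x. snd (prod_decode (f x)))"
  unfolding cmp_def using cComp computes_PSnd by (metis enc_nat_def)

lemma cmp_Pair [cmp_intros]: "cmp Z f \<Longrightarrow> cmp Z g \<Longrightarrow> cmp Z (\<lambda>x. (f x, g x))"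
  unfolding cmp_def using cPair by fastforce

lemma cmp_fst [cmp_intros]: "cmp Z f \<Longrightarrow> cmp Z (\<lambda>x. fst (f x))"
proof -
  assume "cmp Z f"
  then have "cmp Z (\<lambda>x. fst (prod_decode (enc (f x))))" by (intro cmp_intros)
  then show ?thesis by (simp add: cmp_def)
qed

lemma cmp_snd [cmp_intros]: "cmp Z f \<Longrightarrow> cmp Z (\<lambda>x. snd (f x))"
proof -
  assume "cmp Z f"
  then have "cmp Z (\<lambda>x. snd (prod_decode (enc (f x))))" by (intro cmp_intros)
  then show ?thesis by (simp add: cmp_def)
qed

lemma cmp_Suc [cmp_intros]: "cmp Z f \<Longrightarrow> cmp Z (\<lambda>x. Suc (f x))"
  unfolding cmp_def using cComp cSucc by (metis enc_nat_def)

text \<open>\<open>PRec\<close> hands its step program the parameter, the counter and the previous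
  value as a nested pair; the assumption on \<open>h\<close> has the shape of this argument, with
  all of \<open>x\<close> as parameter.\<close>

lemma cmp_rec_nat [cmp_intros]:
  assumes "cmp Z a" "cmp Z (\<lambda>v. h (fst v) (fst (snd v)) (snd (snd v)))" "cmp Z k"
  shows "cmp Z (\<lambda>x. rec_nat (a x) (\<lambda>n r. h x n r) (k x))"
proof -
  from assms obtain pa ph pk where p: "\<And>x. computes Z pa (enc x) (enc (a x))"
    "\<And>x n r. computes Z ph (prod_encode (enc x, prod_encode (n, enc r))) (enc (h x n r))"
    "\<And>x. computes Z pk (enc x) (k x)"
    unfolding cmp_def by fastforce
  have "computes Z (PRec pa ph) (prod_encode (enc x, n)) (enc (rec_nat (a x) (\<lambda>n r. h x n r) n))" for x n
    by (induction n) (auto intro: cRec_0 cRec_Suc p)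
  then have "computes Z (PComp (PRec pa ph) (PPair (PPair PFst PSnd) pk)) (enc x)
      (enc (rec_nat (a x) (\<lambda>n r. h x n r) (k x)))" for x
    by (blast intro: cComp cPair computes_identity p)
  then show ?thesis unfolding cmp_def by blast
qed

section \<open>Case distinction, logic and arithmetic\<close>

lemma cmp_If [cmp_intros]:
  assumes "cmp Z P" "cmp Z f" "cmp Z g"
  shows "cmp Z (\<lambda>x. if P x then f x else g x)"
proof -
  \<comment> \<open>The code of the condition is the length of the recursion: no round leaves the
    else branch, one round replaces it.\<close>
  have "cmp Z (\<lambda>x. rec_nat (enc (g x)) (\<lambda>_ _. enc (f x)) (enc (P x)))"
    by (intro cmp_intros assms cmp_comp[OF assms(2)])
  also have "(\<lambda>x. rec_nat (enc (g x)) (\<lambda>_ _. enc (f x)) (enc (P x))) = (\<lambda>x. enc (if P x then f x else g x))"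
    by auto
  finally show ?thesis by (simp only: cmp_encode)
qed

lemma cmp_Not [cmp_intros]: "cmp Z P \<Longrightarrow> cmp Z (\<lambda>x. \<not> P x)"
proof -
  have "(\<lambda>x. \<not> P x) = (\<lambda>x. if P x then False else True)" by auto
  then show "cmp Z P \<Longrightarrow> ?thesis" by (simp only: cmp_If cmp_const)
qed

lemma cmp_conj [cmp_intros]: "cmp Z P \<Longrightarrow> cmp Z Q \<Longrightarrow> cmp Z (\<lambda>x. P x \<and> Q x)"
proof -
  have "(\<lambda>x. P x \<and> Q x) = (\<lambda>x. if P x then Q x else False)" by auto
  then show "cmp Z P \<Longrightarrow> cmp Z Q \<Longrightarrow> ?thesis" by (simp only: cmp_If cmp_const)
qed

lemma cmp_disj [cmp_intros]: "cmp Z P \<Longrightarrow> cmp Z Q \<Longrightarrow> cmp Z (\<lambda>x. P x \<or> Q x)"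
proof -
  have "(\<lambda>x. P x \<or> Q x) = (\<lambda>x. if P x then True else Q x)" by auto
  then show "cmp Z P \<Longrightarrow> cmp Z Q \<Longrightarrow> ?thesis" by (simp only: cmp_If cmp_const)
qed

lemma cmp_imp [cmp_intros]: "cmp Z P \<Longrightarrow> cmp Z Q \<Longrightarrow> cmp Z (\<lambda>x. P x \<longrightarrow> Q x)"
  unfolding imp_conv_disj by (intro cmp_disj cmp_Not)

lemma cmp_eq_0:
  assumes "cmp Z f" shows "cmp Z (\<lambda>x. f x = (0::nat))"
proof -
  have "cmp Z (\<lambda>x. rec_nat True (\<lambda>_ _. False) (f x))"
    by (intro cmp_intros assms)
  also have "(\<lambda>x. rec_nat True (\<lambda>_ _. False) (f x)) = (\<lambda>x. f x = 0)"
    by (intro ext, case_tac "f x") simp_all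
  finally show ?thesis .
qed

lemma cmp_pred:
  assumes "cmp Z f" shows "cmp Z (\<lambda>x. f x - Suc 0)"
proof -
  have "cmp Z (\<lambda>x. rec_nat 0 (\<lambda>n _. n) (f x))"
    by (intro cmp_intros assms)
  also have "(\<lambda>x. rec_nat 0 (\<lambda>n _. n) (f x)) = (\<lambda>x. f x - Suc 0)"
    by (intro ext, case_tac "f x") simp_all
  finally show ?thesis .
qed

lemma cmp_diff [cmp_intros]:
  assumes "cmp Z f" "cmp Z g" shows "cmp Z (\<lambda>x. f x - g x :: nat)"
proof -
  have "cmp Z (\<lambda>x. rec_nat (f x) (\<lambda>_ r. r - Suc 0) (g x))"
    by (intro cmp_intros assms cmp_pred)
  moreover have "rec_nat m (\<lambda>_ r. r - Suc 0) n = m - n" for m n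
    by (induction n) auto
  ultimately show ?thesis by (simp only:)
qed

lemma cmp_add [cmp_intros]:
  assumes "cmp Z f" "cmp Z g" shows "cmp Z (\<lambda>x. f x + g x :: nat)"
proof -
  have "cmp Z (\<lambda>x. rec_nat (f x) (\<lambda>_ r. Suc r) (g x))"
    by (intro cmp_intros assms)
  moreover have "rec_nat m (\<lambda>_ r. Suc r) n = m + n" for m n
    by (induction n) auto
  ultimately show ?thesis by (simp only:)
qed

lemma cmp_mult [cmp_intros]:
  assumes "cmp Z f" "cmp Z g" shows "cmp Z (\<lambda>x. f x * g x :: nat)"
proof -
  have "cmp Z (\<lambda>x. rec_nat 0 (\<lambda>_ r. r + f x) (g x))"
    by (intro cmp_intros assms cmp_comp[OF assms(1)])
  moreover have "rec_nat 0 (\<lambda>_ r. r + m) n = m * n" for m n :: nat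
    by (induction n) auto
  ultimately show ?thesis by (simp only:)
qed

lemma cmp_power [cmp_intros]:
  assumes "cmp Z f" "cmp Z g" shows "cmp Z (\<lambda>x. f x ^ g x :: nat)"
proof -
  have "cmp Z (\<lambda>x. rec_nat 1 (\<lambda>_ r. r * f x) (g x))"
    by (intro cmp_intros assms cmp_comp[OF assms(1)])
  moreover have "rec_nat 1 (\<lambda>_ r. r * m) n = m ^ n" for m n :: nat
    by (induction n) auto
  ultimately show ?thesis by (simp only:)
qed

lemma cmp_le [cmp_intros]: "cmp Z f \<Longrightarrow> cmp Z g \<Longrightarrow> cmp Z (\<lambda>x. (f x :: nat) \<le> g x)"
  using cmp_eq_0[OF cmp_diff[of Z f g]] by simp

lemma cmp_less [cmp_intros]: "cmp Z f \<Longrightarrow> cmp Z g \<Longrightarrow> cmp Z (\<lambda>x. (f x :: nat) < g x)"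
  using cmp_Not[OF cmp_le[of Z g f]] by (simp add: not_le)

lemma cmp_eq_nat [cmp_intros]: "cmp Z f \<Longrightarrow> cmp Z g \<Longrightarrow> cmp Z (\<lambda>x. (f x :: nat) = g x)"
  using cmp_conj[OF cmp_le[of Z f g] cmp_le[of Z g f]] by (simp add: order_eq_iff)

lemma cmp_oracle [cmp_intros]: "cmp Z f \<Longrightarrow> cmp Z (\<lambda>x. f x \<in> Z)"
proof -
  assume "cmp Z f"
  then obtain p where "\<And>x. computes Z p (enc x) (f x)" unfolding cmp_def by auto
  then have "computes Z (PComp POracle p) (enc x) (if f x \<in> Z then 1 else 0)" for x
    by (blast intro: cComp cOracle)
  then show ?thesis unfolding cmp_def enc_bool_def by blast
qed

lemma cmp_ex_less [cmp_intros]: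
  fixes P :: "'a::encodable \<Rightarrow> nat \<Rightarrow> bool"
  assumes "cmp Z (\<lambda>v. P (fst v) (snd v))" "cmp Z f"
  shows "cmp Z (\<lambda>x. \<exists>n<f x. P x n)"
proof -
  have "cmp Z (\<lambda>v. P (fst v) (fst (snd v)))"
    using cmp_comp[OF assms(1), of "\<lambda>v. (fst v, fst (snd v))"] by (simp add: cmp_intros)
  then have "cmp Z (\<lambda>x. rec_nat False (\<lambda>n r. r \<or> P x n) (f x))"
    by (intro cmp_intros assms)
  moreover have "rec_nat False (\<lambda>n r. r \<or> P x n) m \<longleftrightarrow> (\<exists>n<m. P x n)" for x m
    by (induction m) (auto simp: less_Suc_eq)
  ultimately show ?thesis by (simp only:)
qed

lemma cmp_all_less [cmp_intros]:
  fixes P :: "'a::encodable \<Rightarrow> nat \<Rightarrow> bool"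
  assumes "cmp Z (\<lambda>v. P (fst v) (snd v))" "cmp Z f"
  shows "cmp Z (\<lambda>x. \<forall>n<f x. P x n)"
proof -
  have "cmp Z (\<lambda>x. \<not> (\<exists>n<f x. \<not> P x n))" by (intro cmp_Not cmp_ex_less assms)
  then show ?thesis by simp
qed

lemma cmp_funpow [cmp_intros]:
  fixes f :: "'a::encodable \<Rightarrow> 'b::encodable \<Rightarrow> 'b"
  assumes "cmp Z k" "cmp Z a" "cmp Z (\<lambda>v. f (fst v) (snd v))"
  shows "cmp Z (\<lambda>x. (f x ^^ k x) (a x))"
proof -
  have "cmp Z (\<lambda>v. f (fst v) (snd (snd v)))"
    using cmp_comp[OF assms(3), of "\<lambda>v. (fst v, snd (snd v))"] by (simp add: cmp_intros)
  then have "cmp Z (\<lambda>x. rec_nat (a x) (\<lambda>_ r. f x r) (k x))"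
    by (intro cmp_intros assms)
  moreover have "rec_nat b (\<lambda>_ r. g r) n = (g ^^ n) b" for b n and g :: "'b \<Rightarrow> 'b"
    by (induction n) auto
  ultimately show ?thesis by (simp only:)
qed

section \<open>Lists and options\<close>

lemma cmp_Cons [cmp_intros]: "cmp Z f \<Longrightarrow> cmp Z g \<Longrightarrow> cmp Z (\<lambda>x. f x # g x)"
  using cmp_Suc[OF cmp_prod_encode[OF cmp_enc[of Z f] cmp_enc[of Z g]]]
  by (simp add: cmp_def)

lemma cmp_eq_Nil [cmp_intros]:
  fixes f :: "'a::encodable \<Rightarrow> 'b::encodable list"
  shows "cmp Z f \<Longrightarrow> cmp Z (\<lambda>x. f x = [])"
proof -
  have "enc l = 0 \<longleftrightarrow> l = []" for l :: "'b list" by (cases l) auto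
  then show "cmp Z f \<Longrightarrow> ?thesis" using cmp_eq_0[OF cmp_enc[of Z f]] by simp
qed

lemma cmp_tl [cmp_intros]:
  fixes f :: "'a::encodable \<Rightarrow> 'b::encodable list"
  assumes "cmp Z f" shows "cmp Z (\<lambda>x. tl (f x))"
proof -
  have "cmp Z (\<lambda>x. if f x = [] then 0 else snd (prod_decode (enc (f x) - Suc 0)))"
    by (intro cmp_intros assms)
  moreover have "(if l = [] then 0 else snd (prod_decode (enc l - Suc 0))) = enc (tl l)" for l :: "'b list"
    by (cases l) auto
  ultimately show ?thesis by (simp only: cmp_encode)
qed

text \<open>\<open>hd []\<close> is unspecified, but its code is a fixed number, which some program outputs.\<close>

lemma cmp_hd [cmp_intros]:
  fixes f :: "'a::encodable \<Rightarrow> 'b::encodable list"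
  assumes "cmp Z f" shows "cmp Z (\<lambda>x. hd (f x))"
proof -
  have "cmp Z (\<lambda>x. if f x = [] then enc (hd [] :: 'b) else fst (prod_decode (enc (f x) - Suc 0)))"
    by (intro cmp_intros assms)
  moreover have "(if l = [] then enc (hd [] :: 'b) else fst (prod_decode (enc l - Suc 0))) = enc (hd l)" for l :: "'b list"
    by (cases l) auto
  ultimately show ?thesis by (simp only: cmp_encode)
qed

lemma cmp_Some [cmp_intros]: "cmp Z f \<Longrightarrow> cmp Z (\<lambda>x. Some (f x))"
  using cmp_Suc[OF cmp_enc[of Z f]] by (simp add: cmp_def)

lemma cmp_eq_None [cmp_intros]:
  fixes f :: "'a::encodable \<Rightarrow> 'b::encodable option"
  shows "cmp Z f \<Longrightarrow> cmp Z (\<lambda>x. f x = None)"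
proof -
  have "enc l = 0 \<longleftrightarrow> l = None" for l :: "'b option" by (cases l) auto
  then show "cmp Z f \<Longrightarrow> ?thesis" using cmp_eq_0[OF cmp_enc[of Z f]] by simp
qed

lemma cmp_the [cmp_intros]:
  fixes f :: "'a::encodable \<Rightarrow> 'b::encodable option"
  assumes "cmp Z f" shows "cmp Z (\<lambda>x. the (f x))"
proof -
  have "cmp Z (\<lambda>x. if f x = None then enc (the None :: 'b) else enc (f x) - Suc 0)"
    by (intro cmp_intros assms)
  moreover have "(if l = None then enc (the None :: 'b) else enc l - Suc 0) = enc (the l)" for l :: "'b option"
    by (cases l) auto
  ultimately show ?thesis by (simp only: cmp_encode)
qed

text \<open>Bounds the rounds of a loop over a list by the code of the list, which is available
  before \<open>length\<close> is known to be computable.\<close>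

lemma length_le_enc: "length l \<le> enc (l :: 'a::encodable list)"
proof (induction l)
  case (Cons x l)
  have "enc l \<le> prod_encode (enc x, enc l)" by (rule le_prod_encode_2)
  with Cons show ?case by simp
qed simp

lemma cmp_foldl [cmp_intros]:
  fixes f :: "'a::encodable \<Rightarrow> 'c::encodable \<Rightarrow> 'b::encodable \<Rightarrow> 'c"
  assumes "cmp Z (\<lambda>v. f (fst v) (fst (snd v)) (snd (snd v)))" "cmp Z a" "cmp Z l"
  shows "cmp Z (\<lambda>x. foldl (\<lambda>r y. f x r y) (a x) (l x))"
proof -
  \<comment> \<open>Each round consumes one element and is idle on the empty list, so surplus rounds
    are harmless.\<close>
  define g where "g x s = (if snd s = [] then s else (f x (fst s) (hd (snd s)), tl (snd s)))" for x s
  have "cmp Z (\<lambda>v. f (fst v) (fst (snd v)) (hd (snd (snd v))))"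
    using cmp_comp[OF assms(1), of "\<lambda>v. (fst v, fst (snd v), hd (snd (snd v)))"] by (simp add: cmp_intros)
  then have "cmp Z (\<lambda>v. g (fst v) (snd v))"
    unfolding g_def by (intro cmp_intros)
  then have "cmp Z (\<lambda>x. fst ((g x ^^ enc (l x)) (a x, l x)))"
    by (intro cmp_intros assms)
  moreover have "fst ((g x ^^ n) (b, m)) = foldl (\<lambda>r y. f x r y) b m" if "length m \<le> n" for x n b m
    using that
  proof (induction n arbitrary: b m)
    case (Suc n)
    then show ?case
      by (cases m) (simp_all add: g_def funpow_Suc_right del: funpow.simps)
  qed simp
  then have "(\<lambda>x. fst ((g x ^^ enc (l x)) (a x, l x))) = (\<lambda>x. foldl (\<lambda>r y. f x r y) (a x) (l x))"
    using length_le_enc by blast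
  ultimately show ?thesis by (simp only:)
qed

lemma cmp_length [cmp_intros]:
  fixes l :: "'a::encodable \<Rightarrow> 'b::encodable list"
  assumes "cmp Z l" shows "cmp Z (\<lambda>x. length (l x))"
proof -
  have "cmp Z (\<lambda>x. foldl (\<lambda>r _. Suc r) 0 (l x))" by (intro cmp_intros assms)
  moreover have "foldl (\<lambda>r _. Suc r) n m = n + length m" for n and m :: "'b list"
    by (induction m arbitrary: n) auto
  ultimately show ?thesis by simp
qed

lemma cmp_bex_list [cmp_intros]:
  fixes P :: "'a::encodable \<Rightarrow> 'b::encodable \<Rightarrow> bool"
  assumes "cmp Z (\<lambda>v. P (fst v) (snd v))" "cmp Z l"
  shows "cmp Z (\<lambda>x. \<exists>y\<in>set (l x). P x y)"
proof -
  have "cmp Z (\<lambda>v. P (fst v) (snd (snd v)))"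
    using cmp_comp[OF assms(1), of "\<lambda>v. (fst v, snd (snd v))"] by (simp add: cmp_intros)
  then have "cmp Z (\<lambda>x. foldl (\<lambda>r y. r \<or> P x y) False (l x))" by (intro cmp_intros assms)
  moreover have "foldl (\<lambda>r y. r \<or> P x y) b m \<longleftrightarrow> b \<or> (\<exists>y\<in>set m. P x y)" for b x and m :: "'b list"
    by (induction m arbitrary: b) auto
  ultimately show ?thesis by simp
qed

lemma cmp_member_list [cmp_intros]:
  assumes "cmp Z f" "cmp Z l"
  shows "cmp Z (\<lambda>x. (f x :: nat) \<in> set (l x))"
proof -
  have "cmp Z (\<lambda>x. \<exists>y\<in>set (l x). y = f x)" by (intro cmp_intros assms cmp_comp[OF assms(1)])
  then show ?thesis by simp
qed

lemma cmp_append [cmp_intros]: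
  fixes f :: "'a::encodable \<Rightarrow> 'b::encodable list"
  assumes "cmp Z f" "cmp Z g"
  shows "cmp Z (\<lambda>x. f x @ g x)"
proof -
  have *: "foldl (\<lambda>r y. y # r) n m = rev m @ n" for n m :: "'b list"
    by (induction m arbitrary: n) auto
  have "cmp Z (\<lambda>x. foldl (\<lambda>r y. y # r) (g x) (foldl (\<lambda>r y. y # r) [] (f x)))"
    by (intro cmp_intros assms)
  then show ?thesis by (simp add: *)
qed

lemma cmp_filter [cmp_intros]:
  fixes P :: "'a::encodable \<Rightarrow> 'b::encodable \<Rightarrow> bool"
  assumes "cmp Z (\<lambda>v. P (fst v) (snd v))" "cmp Z l"
  shows "cmp Z (\<lambda>x. filter (\<lambda>y. P x y) (l x))"
proof -
  have "cmp Z (\<lambda>v. P (fst v) (snd (snd v)))"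
    using cmp_comp[OF assms(1), of "\<lambda>v. (fst v, snd (snd v))"] by (simp add: cmp_intros)
  then have "cmp Z (\<lambda>x. foldl (\<lambda>r y. if P x y then r @ [y] else r) [] (l x))"
    by (intro cmp_intros assms)
  moreover have "foldl (\<lambda>r y. if P x y then r @ [y] else r) n m = n @ filter (P x) m" for x n m
    by (induction m arbitrary: n) auto
  ultimately show ?thesis by simp
qed

lemma cmp_map [cmp_intros]:
  fixes f :: "'a::encodable \<Rightarrow> 'b::encodable \<Rightarrow> 'c::encodable"
  assumes "cmp Z (\<lambda>v. f (fst v) (snd v))" "cmp Z l"
  shows "cmp Z (\<lambda>x. map (\<lambda>y. f x y) (l x))"
proof -
  have "cmp Z (\<lambda>v. f (fst v) (snd (snd v)))"
    using cmp_comp[OF assms(1), of "\<lambda>v. (fst v, snd (snd v))"] by (simp add: cmp_intros)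
  then have "cmp Z (\<lambda>x. foldl (\<lambda>r y. r @ [f x y]) [] (l x))"
    by (intro cmp_intros assms)
  moreover have "foldl (\<lambda>r y. r @ [f x y]) n m = n @ map (f x) m" for x n m
    by (induction m arbitrary: n) auto
  ultimately show ?thesis by simp
qed

lemma cmp_upt [cmp_intros]:
  assumes "cmp Z f"
  shows "cmp Z (\<lambda>x. [0..<f x])"
proof -
  have "cmp Z (\<lambda>x. rec_nat [] (\<lambda>n r. r @ [n]) (f x))"
    by (intro cmp_intros assms)
  moreover have "rec_nat [] (\<lambda>n r. r @ [n]) n = [0..<n]" for n
    by (induction n) auto
  ultimately show ?thesis by (simp only:)
qed

text \<open>\<open>PMin\<close> looks for the value 0, whereas truth is coded by 1; predicates are
  therefore negated before a search.\<close>

lemma if_not: "(if \<not> b then x else y) = (if b then y else x)"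
  by simp

lemma computes_PMin_Least:
  assumes "\<And>n. computes Z p (prod_encode (x, n)) (if P n then 0 else 1)" "P m"
  shows "computes Z (PMin p) x (LEAST n. P n)"
proof (rule cMin)
  show "computes Z p (prod_encode (x, LEAST n. P n)) 0"
    using assms(1)[of "LEAST n. P n"] LeastI[of P, OF assms(2)] by simp
  have "computes Z p (prod_encode (x, m)) (Suc 0)" if "m < (LEAST n. P n)" for m
    using assms(1)[of m] not_less_Least[OF that] by simp
  then show "\<forall>m<LEAST n. P n. \<exists>k. computes Z p (prod_encode (x, m)) (Suc k)"
    by blast
qed

lemma cmp_Least [cmp_intros]:
  fixes P :: "'a::encodable \<Rightarrow> nat \<Rightarrow> bool"
  assumes "cmp Z (\<lambda>v. P (fst v) (snd v))" "\<And>x. \<exists>n. P x n"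
  shows "cmp Z (\<lambda>x. LEAST n. P x n)"
proof -
  from cmp_Not[OF assms(1)] obtain p where
    "\<And>v. computes Z p (enc v) (enc (\<not> P (fst v) (snd v)))"
    unfolding cmp_def by blast
  from this[of "(x, n)" for x n] have
    "computes Z p (prod_encode (enc x, n)) (if P x n then 0 else 1)" for x n
    by (simp only: enc_prod_def enc_bool_def enc_nat_def fst_conv snd_conv if_not)
  then have "computes Z (PMin p) (enc x) (LEAST n. P x n)" for x
    using computes_PMin_Least assms(2) by metis
  then show ?thesis unfolding cmp_def by auto
qed

lemma cmp_computable_in: "cmp Z f \<longleftrightarrow> computable_in Z f"
  for f :: "nat \<Rightarrow> nat"
  unfolding cmp_def computable_in_def by simp

lemma ce_exists:
  fixes P :: "nat \<Rightarrow> nat \<Rightarrow> bool"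
  assumes "cmp {} (\<lambda>v. P (fst v) (snd v))"
  shows "ce {x. \<exists>n. P x n}"
proof -
  from cmp_Not[OF assms] obtain p where
    "\<And>v. computes {} p (enc v) (enc (\<not> P (fst v) (snd v)))"
    unfolding cmp_def by blast
  from this[of "(x, n)" for x n] have
    p: "computes {} p (prod_encode (x, n)) (if P x n then 0 else 1)" for x n
    by (simp only: enc_prod_def enc_bool_def enc_nat_def fst_conv snd_conv if_not)
  have "(\<exists>n. P x n) \<longleftrightarrow> (\<exists>y. computes {} (PMin p) x y)" for x
  proof
    show "\<exists>n. P x n \<Longrightarrow> \<exists>y. computes {} (PMin p) x y"
      using computes_PMin_Least[OF p] by blast
    assume "\<exists>y. computes {} (PMin p) x y"
    then obtain n where "computes {} p (prod_encode (x, n)) 0"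
      by (auto elim: computes_PMinE)
    from computes_det[OF this p[of x n]] have "P x n" by (simp split: if_splits)
    then show "\<exists>n. P x n" ..
  qed
  then show ?thesis unfolding ce_def by auto
qed

section \<open>An abstract machine\<close>

text \<open>Programs are inspected through \<open>tag\<close>, \<open>left\<close> and
  \<open>right\<close>, which are arithmetic on codes, instead of by pattern matching; missing
  components are \<open>PZero\<close>, whose code is 0.\<close>

definition tag :: "prog \<Rightarrow> nat" where
  "tag p = fst (prod_decode (prog_code p))"

primrec left :: "prog \<Rightarrow> prog" where
  "left PZero = PZero"
| "left PSucc = PZero"
| "left PFst = PZero"
| "left PSnd = PZero"
| "left POracle = PZero"
| "left (PPair p q) = p"
| "left (PComp p q) = p"
| "left (PRec p q) = p"
| "left (PMin p) = p"

primrec right :: "prog \<Rightarrow> prog" where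
  "right PZero = PZero"
| "right PSucc = PZero"
| "right PFst = PZero"
| "right PSnd = PZero"
| "right POracle = PZero"
| "right (PPair p q) = q"
| "right (PComp p q) = q"
| "right (PRec p q) = q"
| "right (PMin p) = PZero"

lemma tag_simps [simp]:
  "tag PZero = 0" "tag PSucc = 1" "tag PFst = 2" "tag PSnd = 3" "tag POracle = 4"
  "tag (PPair p q) = 5" "tag (PComp p q) = 6" "tag (PRec p q) = 7" "tag (PMin p) = 8"
  by (simp_all add: tag_def)

lemma prod_encode_0: "prod_encode (0, 0) = 0"
  by (simp add: prod_encode_def)

lemma cmp_tag [cmp_intros]: "cmp Z f \<Longrightarrow> cmp Z (\<lambda>x. tag (f x))"
proof -
  assume "cmp Z f"
  then have "cmp Z (\<lambda>x. fst (prod_decode (enc (f x))))" by (intro cmp_intros)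
  then show ?thesis by (simp add: tag_def)
qed

lemma cmp_left [cmp_intros]:
  assumes "cmp Z f" shows "cmp Z (\<lambda>x. left (f x))"
proof -
  have "cmp Z (\<lambda>x. if tag (f x) < 5 then 0
      else if tag (f x) = 8 then snd (prod_decode (enc (f x)))
      else fst (prod_decode (snd (prod_decode (enc (f x))))))"
    by (intro cmp_intros assms)
  moreover have "(if tag p < 5 then 0 else if tag p = 8 then snd (prod_decode (enc p))
      else fst (prod_decode (snd (prod_decode (enc p))))) = enc (left p)" for p
    by (cases p) (auto simp: prod_encode_0)
  ultimately show ?thesis by (simp only: cmp_encode)
qed

lemma cmp_right [cmp_intros]:
  assumes "cmp Z f" shows "cmp Z (\<lambda>x. right (f x))"
proof -
  have "cmp Z (\<lambda>x. if tag (f x) < 5 then 0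
      else if tag (f x) = 8 then 0
      else snd (prod_decode (snd (prod_decode (enc (f x))))))"
    by (intro cmp_intros assms)
  moreover have "(if tag p < 5 then 0 else if tag p = 8 then 0
      else snd (prod_decode (snd (prod_decode (enc p))))) = enc (right p)" for p
    by (cases p) (auto simp: prod_encode_0)
  ultimately show ?thesis by (simp only: cmp_encode)
qed

lemma cmp_prog_constructors [cmp_intros]:
  assumes "cmp Z f" "cmp Z g"
  shows "cmp Z (\<lambda>x. PPair (f x) (g x))" "cmp Z (\<lambda>x. PComp (f x) (g x))"
    "cmp Z (\<lambda>x. PRec (f x) (g x))"
proof -
  have "cmp Z (\<lambda>x. prod_encode (n, prod_encode (enc (f x), enc (g x))))" for n
    by (intro cmp_intros assms)
  then show "cmp Z (\<lambda>x. PPair (f x) (g x))" "cmp Z (\<lambda>x. PComp (f x) (g x))"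
    "cmp Z (\<lambda>x. PRec (f x) (g x))"
    by (simp_all add: cmp_def)
qed

lemma cmp_PMin [cmp_intros]:
  assumes "cmp Z f"
  shows "cmp Z (\<lambda>x. PMin (f x))"
proof -
  have "cmp Z (\<lambda>x. prod_encode (8, enc (f x)))"
    by (intro cmp_intros assms)
  then show ?thesis
    by (simp add: cmp_def)
qed

text \<open>
  A frame \<open>(t, p, d)\<close> says what to do with the returned value \<open>y\<close>: for \<open>t = 0\<close>, evaluate the second
  component \<open>p\<close> of a pair at \<open>d\<close>; for \<open>t = 1\<close>, form the pair of \<open>d\<close> and \<open>y\<close>; for \<open>t = 2\<close>, evaluate
  the outer function \<open>p\<close> of a composition; for \<open>t = 3\<close>, perform a step of a recursion; for \<open>t = 4\<close>,
  continue a search. In a configuration \<open>((ev, p, x), K)\<close> the flag \<open>ev\<close> tells whether \<open>p\<close> is to be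
  evaluated at \<open>x\<close> or \<open>x\<close> has to be returned. Queries not below the bound \<open>b\<close> block the machine.
\<close>

type_synonym frame = "nat \<times> prog \<times> nat"
type_synonym config = "(bool \<times> prog \<times> nat) \<times> frame list"

abbreviation Eval :: "prog \<Rightarrow> nat \<Rightarrow> frame list \<Rightarrow> config" where
  "Eval p x K \<equiv> ((True, p, x), K)"

abbreviation Ret :: "nat \<Rightarrow> frame list \<Rightarrow> config" where
  "Ret y K \<equiv> ((False, PZero, y), K)"

definition eval_step :: "nat set \<Rightarrow> nat \<Rightarrow> prog \<Rightarrow> nat \<Rightarrow> frame list \<Rightarrow> config" where
  "eval_step Z b p x K =
   (if tag p = 0 then Ret 0 K
    else if tag p = 1 then Ret (Suc x) K
    else if tag p = 2 then Ret (fst (prod_decode x)) K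
    else if tag p = 3 then Ret (snd (prod_decode x)) K
    else if tag p = 4 then (if x < b then Ret (if x \<in> Z then 1 else 0) K else Eval p x K)
    else if tag p = 5 then Eval (left p) x ((0, right p, x) # K)
    else if tag p = 6 then Eval (right p) x ((2, left p, 0) # K)
    else if tag p = 7 then
      (if snd (prod_decode x) = 0 then Eval (left p) (fst (prod_decode x)) K
       else Eval p (prod_encode (fst (prod_decode x), snd (prod_decode x) - 1))
         ((3, right p, prod_encode (fst (prod_decode x), snd (prod_decode x) - 1)) # K))
    else Eval (left p) (prod_encode (x, 0)) ((4, left p, prod_encode (x, 0)) # K))"

definition ret_step :: "nat \<Rightarrow> nat \<Rightarrow> prog \<Rightarrow> nat \<Rightarrow> frame list \<Rightarrow> config" where
  "ret_step y t p d K =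
   (if t = 0 then Eval p d ((1, PZero, y) # K)
    else if t = 1 then Ret (prod_encode (d, y)) K
    else if t = 2 then Eval p y K
    else if t = 3 then
      Eval p (prod_encode (fst (prod_decode d), prod_encode (snd (prod_decode d), y))) K
    else if y = 0 then Ret (snd (prod_decode d)) K
    else Eval p (prod_encode (fst (prod_decode d), Suc (snd (prod_decode d))))
      ((4, p, prod_encode (fst (prod_decode d), Suc (snd (prod_decode d)))) # K))"

definition step :: "nat set \<Rightarrow> nat \<Rightarrow> config \<Rightarrow> config" where
  "step Z b c =
   (if fst (fst c) then eval_step Z b (fst (snd (fst c))) (snd (snd (fst c))) (snd c)
    else if snd c = [] then c
    else ret_step (snd (snd (fst c))) (fst (hd (snd c))) (fst (snd (hd (snd c))))
      (snd (snd (hd (snd c)))) (tl (snd c)))"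

lemma step_simps [simp]:
  "step Z b (Eval PZero x K) = Ret 0 K"
  "step Z b (Eval PSucc x K) = Ret (Suc x) K"
  "step Z b (Eval PFst x K) = Ret (fst (prod_decode x)) K"
  "step Z b (Eval PSnd x K) = Ret (snd (prod_decode x)) K"
  "step Z b (Eval POracle x K) =
    (if x < b then Ret (if x \<in> Z then 1 else 0) K else Eval POracle x K)"
  "step Z b (Eval (PPair p q) x K) = Eval p x ((0, q, x) # K)"
  "step Z b (Eval (PComp p q) x K) = Eval q x ((2, p, 0) # K)"
  "step Z b (Eval (PRec p q) (prod_encode (x, 0)) K) = Eval p x K"
  "step Z b (Eval (PRec p q) (prod_encode (x, Suc n)) K) =
    Eval (PRec p q) (prod_encode (x, n)) ((3, q, prod_encode (x, n)) # K)"
  "step Z b (Eval (PMin p) x K) = Eval p (prod_encode (x, 0)) ((4, p, prod_encode (x, 0)) # K)"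
  "step Z b (Ret y []) = Ret y []"
  "step Z b (Ret y ((0, q, d) # K)) = Eval q d ((1, PZero, y) # K)"
  "step Z b (Ret y ((Suc 0, q, d) # K)) = Ret (prod_encode (d, y)) K"
  "step Z b (Ret y ((2, q, d) # K)) = Eval q y K"
  "step Z b (Ret y ((3, q, prod_encode (x, n)) # K)) = Eval q (prod_encode (x, prod_encode (n, y))) K"
  "step Z b (Ret 0 ((4, q, prod_encode (x, n)) # K)) = Ret n K"
  "step Z b (Ret (Suc y) ((4, q, prod_encode (x, n)) # K)) =
    Eval q (prod_encode (x, Suc n)) ((4, q, prod_encode (x, Suc n)) # K)"
  by (simp_all add: step_def eval_step_def ret_step_def)

definition halted :: "config \<Rightarrow> bool" where
  "halted c \<longleftrightarrow> \<not> fst (fst c) \<and> snd c = []"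

text \<open>A single bound limits both the steps and the oracle queries. Hence a run depends only on
  the oracle below \<open>b\<close>, which is the use principle in \<open>run_cong\<close>.\<close>

definition run :: "nat set \<Rightarrow> nat \<Rightarrow> prog \<Rightarrow> nat \<Rightarrow> nat option" where
  "run Z b p x =
    (if halted ((step Z b ^^ b) (Eval p x [])) then Some (snd (snd (fst ((step Z b ^^ b) (Eval p x [])))))
     else None)"

lemma step_cong:
  assumes "\<And>x. x < b \<Longrightarrow> x \<in> Z \<longleftrightarrow> x \<in> Z'"
  shows "step Z b = step Z' b"
  by (rule ext) (auto simp: step_def eval_step_def assms)

lemma run_cong: "(\<And>x. x < b \<Longrightarrow> x \<in> Z \<longleftrightarrow> x \<in> Z') \<Longrightarrow> run Z b p x = run Z' b p x"
  unfolding run_def using step_cong[of b Z Z'] by simp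

section \<open>Correctness of the machine\<close>

lemma funpow_step_Ret_Nil: "(step Z b ^^ n) (Ret y []) = Ret y []"
  by (induction n) auto

text \<open>The loop of an unbounded search, by induction on the remaining steps, with all values
  below \<open>j\<close> known to be nonzero. \<open>eval\<close> is the induction hypothesis of
  \<open>machine_sound\<close> for the body.\<close>

lemma machine_PMin_sound:
  assumes eval: "\<And>k x K. k < n \<Longrightarrow> halted ((step Z b ^^ k) (Eval p x K)) \<Longrightarrow>
      \<exists>z m. m < k \<and> computes Z p x z \<and> (step Z b ^^ k) (Eval p x K) = (step Z b ^^ m) (Ret z K)"
    and "k < n" "halted ((step Z b ^^ k) (Eval p (prod_encode (x, j)) ((4, p, prod_encode (x, j)) # K)))"
    and "\<forall>i<j. \<exists>r. computes Z p (prod_encode (x, i)) (Suc r)"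
  shows "\<exists>z m. m < k \<and> computes Z (PMin p) x z \<and>
    (step Z b ^^ k) (Eval p (prod_encode (x, j)) ((4, p, prod_encode (x, j)) # K)) = (step Z b ^^ m) (Ret z K)"
  using assms(2-)
proof (induction k arbitrary: j rule: less_induct)
  case (less k)
  from eval[OF less.prems(1,2)] obtain z m where z: "m < k" "computes Z p (prod_encode (x, j)) z"
    "(step Z b ^^ k) (Eval p (prod_encode (x, j)) ((4, p, prod_encode (x, j)) # K))
      = (step Z b ^^ m) (Ret z ((4, p, prod_encode (x, j)) # K))" by blast
  with less.prems(2) obtain m' where m': "m = Suc m'"
    by (cases m) (auto simp: halted_def)
  show ?case
  proof (cases z)
    case 0
    with z m' less.prems have "computes Z (PMin p) x j" by (auto intro: cMin)
    with 0 z m' show ?thesis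
      by (intro exI[of _ j] exI[of _ m']) (simp add: funpow_Suc_right del: funpow.simps)
  next
    case (Suc r)
    have eq: "(step Z b ^^ m) (Ret z ((4, p, prod_encode (x, j)) # K)) =
        (step Z b ^^ m') (Eval p (prod_encode (x, Suc j)) ((4, p, prod_encode (x, Suc j)) # K))"
      using Suc m' by (simp add: funpow_Suc_right del: funpow.simps)
    have "\<forall>i<Suc j. \<exists>r. computes Z p (prod_encode (x, i)) (Suc r)"
      using less.prems(3) z(2) Suc by (auto simp: less_Suc_eq)
    from less.IH[OF _ _ _ this] z eq m' less.prems
    show ?thesis by (smt (verit) less_SucI less_trans lessI)
  qed
qed

text \<open>A halting run must return a value to the stack \<open>K\<close> it started with.
  Recording that strictly fewer steps remain lets strong induction on \<open>n\<close> treat a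
  subevaluation and then its continuation.\<close>

lemma machine_sound:
  assumes "halted ((step Z b ^^ n) (Eval p x K))"
  shows "\<exists>z m. m < n \<and> computes Z p x z \<and> (step Z b ^^ n) (Eval p x K) = (step Z b ^^ m) (Ret z K)"
  using assms
proof (induction n arbitrary: p x K rule: less_induct)
  case (less n)
  from less.prems obtain n' where n': "n = Suc n'"
    by (cases n) (auto simp: halted_def)
  then have lt: "n' < n" by simp
  have eq: "(step Z b ^^ n) c = (step Z b ^^ n') (step Z b c)" for c
    using n' by (simp add: funpow_Suc_right del: funpow.simps)
  \<comment> \<open>After the subevaluation the frame \<open>F\<close> is still on the stack, so the
    machine has not halted and makes at least one more step, which processes
    \<open>F\<close>.\<close>
  have sub: "\<exists>z m. m < k \<and> Suc m < n \<and> computes Z q y z \<and> C = (step Z b ^^ m) (step Z b (Ret z (F # K')))"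
    if "C = (step Z b ^^ k) (Eval q y (F # K'))" "halted C" "k < n" for C k q y F K'
  proof -
    from less.IH[of k q y "F # K'"] that obtain z m where z: "m < k" "computes Z q y z"
      "C = (step Z b ^^ m) (Ret z (F # K'))" by blast
    with \<open>halted C\<close> obtain m' where "m = Suc m'" by (cases m) (auto simp: halted_def)
    with z \<open>k < n\<close> show ?thesis
      by (intro exI[of _ z] exI[of _ m']) (simp add: funpow_Suc_right del: funpow.simps)
  qed
  define C where "C = (step Z b ^^ n) (Eval p x K)"
  have C: "halted C" using less.prems by (simp add: C_def)
  show ?case
  proof (cases p)
    case PZero
    with lt show ?thesis
      by (intro exI[of _ "0"] exI[of _ n']) (simp add: eq cZero)
  next
    case PSucc
    with lt show ?thesis
      by (intro exI[of _ "Suc x"] exI[of _ n']) (simp add: eq cSucc)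
  next
    case PFst
    with lt show ?thesis
      by (intro exI[of _ "fst (prod_decode x)"] exI[of _ n']) (simp add: eq computes_PFst)
  next
    case PSnd
    with lt show ?thesis
      by (intro exI[of _ "snd (prod_decode x)"] exI[of _ n']) (simp add: eq computes_PSnd)
  next
    case POracle
    show ?thesis
    proof (cases "x < b")
      case True
      with POracle lt show ?thesis
        by (intro exI[of _ "if x \<in> Z then 1 else 0"] exI[of _ n'] conjI cOracle) (simp_all add: eq cOracle)
    next
      case False
      \<comment> \<open>A blocked query is a fixed point of the machine, so the run never
        halts.\<close>
      then have "(step Z b ^^ m) (Eval POracle x K) = Eval POracle x K" for m
        by (induction m) auto
      with less.prems POracle show ?thesis by (simp add: halted_def)
    qed
  next
    case (PPair q r)
    have "C = (step Z b ^^ n') (Eval q x ((0, r, x) # K))" by (simp add: C_def eq PPair)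
    from sub[OF this C lt] obtain y m where y: "Suc m < n" "computes Z q x y"
      "C = (step Z b ^^ m) (Eval r x ((1, PZero, y) # K))" by auto
    from sub[OF y(3) C] y(1) obtain z k where z: "Suc k < n" "computes Z r x z"
      "C = (step Z b ^^ k) (Ret (prod_encode (y, z)) K)"
      by auto
    moreover have "computes Z p x (prod_encode (y, z))" using PPair y z cPair by blast
    ultimately show ?thesis unfolding C_def
      by (intro exI[of _ "prod_encode (y, z)"] exI[of _ k]) simp
  next
    case (PComp q r)
    have "C = (step Z b ^^ n') (Eval r x ((2, q, 0) # K))" by (simp add: C_def eq PComp)
    from sub[OF this C lt] obtain y m where y: "Suc m < n" "computes Z r x y"
      "C = (step Z b ^^ m) (Eval q y K)" by auto
    with less.IH[of m q y K] C obtain z k where z: "k < m" "computes Z q y z"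
      "C = (step Z b ^^ k) (Ret z K)" by auto
    moreover have "computes Z p x z" using PComp y z cComp by blast
    ultimately show ?thesis using y(1) unfolding C_def
      by (intro exI[of _ z] exI[of _ k]) simp
  next
    case (PRec q r)
    obtain u j where x: "x = prod_encode (u, j)" by (metis prod_decode_inverse surj_pair)
    show ?thesis
    proof (cases j)
      case 0
      have "C = (step Z b ^^ n') (Eval q u K)" by (simp add: C_def eq PRec x 0)
      with less.IH[OF lt, of q u K] C obtain z m where z: "m < n'" "computes Z q u z"
        "C = (step Z b ^^ m) (Ret z K)" by auto
      moreover have "computes Z p x z" using cRec_0 PRec x 0 z by blast
      ultimately show ?thesis using lt unfolding C_def by (intro exI[of _ z] exI[of _ m]) simp
    next
      case (Suc i)
      have "C = (step Z b ^^ n') (Eval p (prod_encode (u, i)) ((3, r, prod_encode (u, i)) # K))"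
        by (simp add: C_def eq PRec x Suc)
      from sub[OF this C lt] obtain y m where y: "Suc m < n" "computes Z p (prod_encode (u, i)) y"
        "C = (step Z b ^^ m) (Eval r (prod_encode (u, prod_encode (i, y))) K)" by auto
      with less.IH[of m r "prod_encode (u, prod_encode (i, y))" K] C obtain z k where z: "k < m"
        "computes Z r (prod_encode (u, prod_encode (i, y))) z"
        "C = (step Z b ^^ k) (Ret z K)" by auto
      moreover have "computes Z p x z" using cRec_Suc PRec x y z Suc by blast
      ultimately show ?thesis using y(1) unfolding C_def by (intro exI[of _ z] exI[of _ k]) simp
    qed
  next
    case (PMin q)
    have "\<exists>z m. m < n' \<and> computes Z (PMin q) x z \<and>
      (step Z b ^^ n') (Eval q (prod_encode (x, 0)) ((4, q, prod_encode (x, 0)) # K)) = (step Z b ^^ m) (Ret z K)"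
      by (rule machine_PMin_sound[of n]) (use less.IH C lt in \<open>auto simp: C_def eq PMin\<close>)
    then show ?thesis using PMin lt eq by (auto intro: less_trans)
  qed
qed

lemma run_sound: "run Z b p x = Some y \<Longrightarrow> computes Z p x y"
  unfolding run_def using machine_sound[of b Z b p x "[]"]
  by (auto simp: funpow_step_Ret_Nil split: if_splits)

text \<open>The number of steps and the lower bound for \<open>b\<close> do not depend on
  \<open>K\<close>, so the relation can be used beneath further frames; transitivity takes the
  larger of two bounds.\<close>

definition leads_to :: "nat set \<Rightarrow> (frame list \<Rightarrow> config) \<Rightarrow> (frame list \<Rightarrow> config) \<Rightarrow> bool" where
  "leads_to Z f g \<longleftrightarrow> (\<exists>n B. \<forall>b\<ge>B. \<forall>K. (step Z b ^^ n) (f K) = g K)"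

lemma leads_to_refl: "leads_to Z f f"
  unfolding leads_to_def by (rule exI[of _ 0]) simp

lemma leads_to_trans [trans]:
  assumes "leads_to Z f g" "leads_to Z g h"
  shows "leads_to Z f h"
proof -
  from assms obtain n B n' B' where n: "\<And>b K. b \<ge> B \<Longrightarrow> (step Z b ^^ n) (f K) = g K"
    "\<And>b K. b \<ge> B' \<Longrightarrow> (step Z b ^^ n') (g K) = h K"
    unfolding leads_to_def by metis
  then have "\<forall>b\<ge>max B B'. \<forall>K. (step Z b ^^ (n' + n)) (f K) = h K"
    by (simp add: funpow_add)
  then show ?thesis unfolding leads_to_def by blast
qed

lemma leads_to_step: "(\<And>b K. b \<ge> B \<Longrightarrow> step Z b (f K) = g K) \<Longrightarrow> leads_to Z f g"
  unfolding leads_to_def by (rule exI[of _ 1]) auto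

lemma leads_to_frame: "leads_to Z f g \<Longrightarrow> leads_to Z (\<lambda>K. f (h K)) (\<lambda>K. g (h K))"
  unfolding leads_to_def by metis

lemma machine_complete:
  "computes Z p x y \<Longrightarrow> leads_to Z (\<lambda>K. Eval p x K) (\<lambda>K. Ret y K)"
proof (induction rule: computes.induct)
  case (cOracle x)
  show ?case by (rule leads_to_step[of "Suc x"]) simp
next
  case (cPair p x y q z)
  have "leads_to Z (\<lambda>K. Eval (PPair p q) x K) (\<lambda>K. Eval p x ((0, q, x) # K))"
    by (rule leads_to_step) simp
  also have "leads_to Z \<dots> (\<lambda>K. Ret y ((0, q, x) # K))"
    by (rule leads_to_frame[OF cPair.IH(1)])
  also have "leads_to Z \<dots> (\<lambda>K. Eval q x ((1, PZero, y) # K))"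
    by (rule leads_to_step) simp
  also have "leads_to Z \<dots> (\<lambda>K. Ret z ((1, PZero, y) # K))"
    by (rule leads_to_frame[OF cPair.IH(2)])
  also have "leads_to Z \<dots> (\<lambda>K. Ret (prod_encode (y, z)) K)"
    by (rule leads_to_step) simp
  finally show ?case .
next
  case (cComp q x y p z)
  have "leads_to Z (\<lambda>K. Eval (PComp p q) x K) (\<lambda>K. Eval q x ((2, p, 0) # K))"
    by (rule leads_to_step) simp
  also have "leads_to Z \<dots> (\<lambda>K. Ret y ((2, p, 0) # K))"
    by (rule leads_to_frame[OF cComp.IH(1)])
  also have "leads_to Z \<dots> (\<lambda>K. Eval p y K)"
    by (rule leads_to_step) simp
  also note cComp.IH(2)
  finally show ?case .
next
  case (cRec_0 p x y q)
  have "leads_to Z (\<lambda>K. Eval (PRec p q) (prod_encode (x, 0)) K) (\<lambda>K. Eval p x K)"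
    by (rule leads_to_step) simp
  also note cRec_0.IH
  finally show ?case .
next
  case (cRec_Suc p q x n y z)
  have "leads_to Z (\<lambda>K. Eval (PRec p q) (prod_encode (x, Suc n)) K)
      (\<lambda>K. Eval (PRec p q) (prod_encode (x, n)) ((3, q, prod_encode (x, n)) # K))"
    by (rule leads_to_step) simp
  also have "leads_to Z \<dots> (\<lambda>K. Ret y ((3, q, prod_encode (x, n)) # K))"
    by (rule leads_to_frame[OF cRec_Suc.IH(1)])
  also have "leads_to Z \<dots> (\<lambda>K. Eval q (prod_encode (x, prod_encode (n, y))) K)"
    by (rule leads_to_step) simp
  also note cRec_Suc.IH(2)
  finally show ?case .
next
  case (cMin p x n)
  have "leads_to Z (\<lambda>K. Eval (PMin p) x K)
      (\<lambda>K. Eval p (prod_encode (x, 0)) ((4, p, prod_encode (x, 0)) # K))"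
    by (rule leads_to_step) simp
  also have "leads_to Z \<dots> (\<lambda>K. Eval p (prod_encode (x, n)) ((4, p, prod_encode (x, n)) # K))"
  proof -
    have "leads_to Z (\<lambda>K. Eval p (prod_encode (x, 0)) ((4, p, prod_encode (x, 0)) # K))
      (\<lambda>K. Eval p (prod_encode (x, m)) ((4, p, prod_encode (x, m)) # K))" if "m \<le> n" for m
      using that
    proof (induction m)
      case (Suc m)
      then obtain k where k: "leads_to Z (\<lambda>K. Eval p (prod_encode (x, m)) K) (\<lambda>K. Ret (Suc k) K)"
        using cMin.IH(2) Suc_le_lessD by blast
      note Suc.IH
      also have "leads_to Z (\<lambda>K. Eval p (prod_encode (x, m)) ((4, p, prod_encode (x, m)) # K))
          (\<lambda>K. Ret (Suc k) ((4, p, prod_encode (x, m)) # K))"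
        by (rule leads_to_frame[OF k])
      also have "leads_to Z \<dots> (\<lambda>K. Eval p (prod_encode (x, Suc m)) ((4, p, prod_encode (x, Suc m)) # K))"
        by (rule leads_to_step) simp
      finally show ?case using Suc.prems by simp
    qed (simp add: leads_to_refl)
    then show ?thesis by simp
  qed
  also have "leads_to Z \<dots> (\<lambda>K. Ret 0 ((4, p, prod_encode (x, n)) # K))"
    by (rule leads_to_frame[OF cMin.IH(1)])
  also have "leads_to Z \<dots> (\<lambda>K. Ret n K)"
    by (rule leads_to_step) simp
  finally show ?case .
qed (rule leads_to_step; simp)+

lemma run_complete:
  assumes "computes Z p x y"
  shows "\<exists>B. \<forall>b\<ge>B. run Z b p x = Some y"
proof -
  from machine_complete[OF assms] obtain n B where
    n: "\<And>b. b \<ge> B \<Longrightarrow> (step Z b ^^ n) (Eval p x []) = Ret y []"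
    unfolding leads_to_def by blast
  have "run Z b p x = Some y" if "b \<ge> max n B" for b
  proof -
    from that have "b = (b - n) + n" by simp
    then have "(step Z b ^^ b) (Eval p x []) = (step Z b ^^ (b - n)) ((step Z b ^^ n) (Eval p x []))"
      by (metis comp_apply funpow_add)
    also have "\<dots> = Ret y []" using n that by (simp add: funpow_step_Ret_Nil)
    finally show ?thesis by (simp add: run_def halted_def)
  qed
  then show ?thesis by blast
qed

text \<open>\<open>W\<close> is the oracle of the simulating program, \<open>Z v\<close> that of the
  simulated run. The cases used are the empty set, the complement of a finite stack, and
  \<open>W\<close> itself.\<close>

lemma cmp_run [cmp_intros]:
  fixes W :: "nat set" and Z :: "'a::encodable \<Rightarrow> nat set"
  assumes Z: "cmp W (\<lambda>v. snd v \<in> Z (fst v))" and b: "cmp W b" and p: "cmp W p" and x: "cmp W x"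
  shows "cmp W (\<lambda>v. run (Z v) (b v) (p v) (x v))"
proof -
  have query: "cmp W (\<lambda>v. g v \<in> Z (f v))"
    if "cmp W f" "cmp W g" for f :: "'a \<times> config \<Rightarrow> 'a" and g
    using cmp_comp[OF Z cmp_Pair[OF that]] by simp
  have "cmp W (\<lambda>v. step (Z (fst v)) (b (fst v)) (snd v))"
    unfolding step_def eval_step_def ret_step_def
    by (intro cmp_intros query cmp_comp[OF b])
  then have "cmp W (\<lambda>v. (step (Z v) (b v) ^^ b v) (Eval (p v) (x v) []))"
    by (intro cmp_intros b p x)
  moreover define C where "C = (\<lambda>v. (step (Z v) (b v) ^^ b v) (Eval (p v) (x v) []))"
  ultimately have "cmp W C" by simp
  then have "cmp W (\<lambda>v. if \<not> fst (fst (C v)) \<and> snd (C v) = [] then Some (snd (snd (fst (C v)))) else None)"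
    by (intro cmp_intros)
  then show ?thesis unfolding run_def halted_def C_def .
qed

section \<open>An enumeration of the programs\<close>

text \<open>
  A number is read as a sequence of instructions for building programs on a stack, in postfix
  notation.
\<close>

definition push_op :: "nat \<Rightarrow> prog list \<Rightarrow> prog list" where
  "push_op t s =
   (if t = 0 then PZero # s
    else if t = 1 then PSucc # s
    else if t = 2 then PFst # s
    else if t = 3 then PSnd # s
    else if t = 4 then POracle # s
    else if t = 5 then PPair (hd (tl s)) (hd s) # tl (tl s)
    else if t = 6 then PComp (hd (tl s)) (hd s) # tl (tl s)
    else if t = 7 then PRec (hd (tl s)) (hd s) # tl (tl s)
    else PMin (hd s) # tl s)"

definition build_step :: "nat \<times> prog list \<Rightarrow> nat \<times> prog list" where
  "build_step c = (snd (prod_decode (fst c)), push_op (fst (prod_decode (fst c))) (snd c))"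

text \<open>A total computable surjection onto programs: \<open>i\<close> codes an instruction
  sequence together with its length. It takes the place of an effective inverse of
  \<open>prog_code\<close>.\<close>

definition prog_of :: "nat \<Rightarrow> prog" where
  "prog_of i = hd (snd ((build_step ^^ snd (prod_decode i)) (fst (prod_decode i), [])))"

lemma cmp_prog_of [cmp_intros]: "cmp Z f \<Longrightarrow> cmp Z (\<lambda>x. prog_of (f x))"
  unfolding prog_of_def build_step_def push_op_def by (intro cmp_intros)

text \<open>Arbitrary remaining instructions \<open>m'\<close> and an arbitrary stack
  \<open>s\<close> make instruction sequences composable.\<close>

definition buildable :: "prog \<Rightarrow> bool" where
  "buildable p \<longleftrightarrow> (\<exists>k. \<forall>m'. \<exists>m. \<forall>s. (build_step ^^ k) (m, s) = (m', p # s))"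

lemma buildable_atom:
  assumes "\<And>s. push_op t s = p # s" shows "buildable p"
proof -
  have "(build_step ^^ 1) (prod_encode (t, m'), s) = (m', p # s)" for m' s
    using assms by (simp add: build_step_def)
  then show ?thesis unfolding buildable_def by blast
qed

lemma buildable_unary:
  assumes "buildable p" "\<And>s. push_op t (p # s) = r # s" shows "buildable r"
proof -
  from assms(1) obtain k f where k: "\<And>m' s. (build_step ^^ k) (f m', s) = (m', p # s)"
    unfolding buildable_def by metis
  have "(build_step ^^ (1 + k)) (f (prod_encode (t, m')), s) = (m', r # s)" for m' s
    using assms(2) k by (simp add: build_step_def)
  then show ?thesis unfolding buildable_def by blast
qed

lemma buildable_binary:
  assumes "buildable p" "buildable q" "\<And>s. push_op t (q # p # s) = r # s" shows "buildable r"
proof -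
  from assms(1) obtain k f where k: "\<And>m' s. (build_step ^^ k) (f m', s) = (m', p # s)"
    unfolding buildable_def by metis
  from assms(2) obtain l g where l: "\<And>m' s. (build_step ^^ l) (g m', s) = (m', q # s)"
    unfolding buildable_def by metis
  have "(build_step ^^ (1 + (l + k))) (f (g (prod_encode (t, m'))), s) = (m', r # s)" for m' s
    using assms(3) k l by (simp add: build_step_def funpow_add)
  then show ?thesis unfolding buildable_def by blast
qed

lemma buildable: "buildable p"
proof (induction p)
  case PZero show ?case by (rule buildable_atom[of 0]) (simp add: push_op_def)
next
  case PSucc show ?case by (rule buildable_atom[of 1]) (simp add: push_op_def)
next
  case PFst show ?case by (rule buildable_atom[of 2]) (simp add: push_op_def)
next
  case PSnd show ?case by (rule buildable_atom[of 3]) (simp add: push_op_def)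
next
  case POracle show ?case by (rule buildable_atom[of 4]) (simp add: push_op_def)
next
  case PPair then show ?case by (rule buildable_binary[of _ _ 5]) (simp add: push_op_def)
next
  case PComp then show ?case by (rule buildable_binary[of _ _ 6]) (simp add: push_op_def)
next
  case PRec then show ?case by (rule buildable_binary[of _ _ 7]) (simp add: push_op_def)
next
  case PMin then show ?case by (rule buildable_unary[of _ 8]) (simp add: push_op_def)
qed

lemma prog_of_surj: "\<exists>i. prog_of i = p"
proof -
  from buildable[of p] obtain k m where "(build_step ^^ k) (m, []) = (0, [p])"
    unfolding buildable_def by blast
  then have "prog_of (prod_encode (m, k)) = p" by (simp add: prog_of_def)
  then show ?thesis ..
qed

text \<open>A larger bound changes a step only at a blocked query. Under the smaller bound such a
  configuration repeats forever, so a halting run never meets one.\<close>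

lemma run_mono:
  assumes "run Z b p x = Some y" "b \<le> b'"
  shows "run Z b' p x = Some y"
proof -
  have eq: "(step Z b' ^^ n) C = (step Z b ^^ n) C" if "halted ((step Z b ^^ n) C)" for n C
    using that
  proof (induction n arbitrary: C)
    case (Suc n)
    have "step Z b' C = step Z b C"
    proof (rule ccontr)
      assume "step Z b' C \<noteq> step Z b C"
      moreover obtain ev q z K where "C = ((ev, q, z), K)" by (metis prod.collapse)
      ultimately have C: "step Z b C = C" "\<not> halted C"
        using assms(2) by (simp_all add: step_def eval_step_def halted_def split: if_splits)
      then have "(step Z b ^^ m) C = C" for m by (induction m) auto
      with Suc.prems C(2) show False by metis
    qed
    with Suc.IH[of "step Z b C"] Suc.prems show ?case
      by (simp add: funpow_Suc_right del: funpow.simps)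
  qed simp
  define C where "C = (step Z b ^^ b) (Eval p x [])"
  from assms(1) have C: "halted C" "y = snd (snd (fst C))"
    by (auto simp: run_def C_def split: if_splits)
  from C(1) eq[of b "Eval p x []"] have "(step Z b' ^^ b) (Eval p x []) = C" by (simp add: C_def)
  moreover have "(step Z b' ^^ m) C = C" for m
    using C(1) by (induction m) (auto simp: step_def halted_def)
  ultimately have "(step Z b' ^^ b') (Eval p x []) = C"
    using assms(2) funpow_add[of "b' - b" b "step Z b'"] by simp
  with C show ?thesis by (simp add: run_def)
qed

section \<open>The construction\<close>

text \<open>The stage is read as a program index and a step bound, so every such pair is tried and
  at most one number enters at a time.\<close>

definition entering :: "nat list \<Rightarrow> nat \<Rightarrow> nat option" where
  "entering l s =
    (if run {} (snd (prod_decode s)) (prog_of (fst (prod_decode s)))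
          (prog_code (prog_of (fst (prod_decode s)))) = None \<or>
        prog_code (prog_of (fst (prod_decode s))) \<in> set l
     then None else Some (prog_code (prog_of (fst (prod_decode s)))))"

text \<open>
  A label \<open>v\<close> encodes a pair of an index of a program and of the least number that is allowed to
  change the approximation as long as the label is respected.
\<close>

type_synonym stack = "(nat \<times> nat list) list"

abbreviation index :: "nat \<Rightarrow> nat" where "index v \<equiv> fst (prod_decode v)"
abbreviation threshold :: "nat \<Rightarrow> nat" where "threshold v \<equiv> snd (prod_decode v)"

definition protected :: "nat \<Rightarrow> nat \<times> nat list \<Rightarrow> bool" where
  "protected n E \<longleftrightarrow> (\<exists>v\<in>set (snd E). threshold v \<le> n)"

definition pop_step :: "nat \<Rightarrow> stack \<Rightarrow> stack" where
  "pop_step n S = (if n < length S \<and> \<not> protected n (hd S) then tl S else S)"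

text \<open>Every effective round shortens the stack, so \<open>length S\<close> rounds reach a
  stack on which \<open>pop_step\<close> does nothing.\<close>

definition pop :: "nat \<Rightarrow> stack \<Rightarrow> stack" where
  "pop n S = (pop_step n ^^ length S) S"

text \<open>As an oracle this also contains the stages not yet reached; a run at stage
  \<open>s\<close> never queries them, as its bound is \<open>s\<close>.\<close>

definition popped :: "stack \<Rightarrow> nat set" where
  "popped S = - set (map fst S)"

text \<open>The bound 2 to the power \<open>-i\<close> on the cost with code \<open>n\<close>, with
  denominators cleared to make the test arithmetical; see \<open>small_iff\<close>.\<close>

definition small :: "nat \<Rightarrow> nat \<Rightarrow> bool" where
  "small i n \<longleftrightarrow> fst (prod_decode n) * 2 ^ i \<le> Suc (snd (prod_decode n))"

text \<open>
  The second component changes whenever a number below the threshold enters the halting problem,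
  so that an injured label gets a fresh witness.
\<close>

definition witness :: "nat list \<Rightarrow> nat \<Rightarrow> nat" where
  "witness l v = prod_encode (v, length (filter (\<lambda>n. n < threshold v) l))"

text \<open>Freedom of the index makes labels of different permanent entries pay with different
  powers of 1/2. The value 0 becomes wrong when the witness is enumerated. The last condition is a
  finite test; \<open>converged\<close> delays the approximation until the relevant costs are
  covered by it.\<close>

definition acts :: "prog \<Rightarrow> stack \<Rightarrow> nat list \<Rightarrow> nat \<Rightarrow> nat \<Rightarrow> bool" where
  "acts c S l s v \<longleftrightarrow>
    \<not> (\<exists>E\<in>set S. \<exists>u\<in>set (snd E). index u = index v) \<and>
    run (popped S) s (prog_of (index v)) (witness l v) \<noteq> None \<and>
    the (run (popped S) s (prog_of (index v)) (witness l v)) = 0 \<and>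
    (\<forall>m<s. threshold v \<le> fst (prod_decode m) \<longrightarrow>
      run (popped S) s c m = None \<or> small (index v) (the (run (popped S) s c m)))"

definition labels :: "prog \<Rightarrow> stack \<Rightarrow> nat list \<Rightarrow> nat \<Rightarrow> nat list" where
  "labels c S l s = filter (acts c S l s) [0..<s]"

definition pop_entering :: "stack \<times> nat list \<Rightarrow> nat \<Rightarrow> stack \<times> nat list" where
  "pop_entering r s =
    (if entering (snd r) s = None then r
     else (pop (the (entering (snd r) s)) (fst r), the (entering (snd r) s) # snd r))"

definition stage :: "prog \<Rightarrow> stack \<times> nat list \<Rightarrow> nat \<Rightarrow> stack \<times> nat list" where
  "stage c r s =
    ((s, labels c (fst (pop_entering r s)) (snd (pop_entering r s)) s) # fst (pop_entering r s),
     snd (pop_entering r s))"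

definition state :: "prog \<Rightarrow> nat \<Rightarrow> stack \<times> nat list" where
  "state c s = rec_nat ([], []) (\<lambda>n r. stage c r n) s"

subsection \<open>Computability\<close>

lemma cmp_prog_code [cmp_intros]: "cmp Z f \<Longrightarrow> cmp Z (\<lambda>x. prog_code (f x))"
  using cmp_enc[of Z f] by simp

lemma cmp_run_empty [cmp_intros]:
  assumes "cmp W b" "cmp W p" "cmp W x"
  shows "cmp W (\<lambda>v. run {} (b v) (p v) (x v))"
  by (rule cmp_run[OF _ assms]) (simp add: cmp_const)

lemma cmp_run_popped [cmp_intros]:
  assumes "cmp W S" "cmp W b" "cmp W p" "cmp W x"
  shows "cmp W (\<lambda>v. run (popped (S v)) (b v) (p v) (x v))"
proof (rule cmp_run[OF _ assms(2-)])
  have "cmp W (\<lambda>v. snd v \<notin> set (map fst (S (fst v))))"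
    by (intro cmp_intros cmp_comp[OF assms(1)])
  then show "cmp W (\<lambda>v. snd v \<in> popped (S (fst v)))"
    unfolding popped_def by simp
qed

lemma cmp_entering [cmp_intros]:
  "cmp Z l \<Longrightarrow> cmp Z s \<Longrightarrow> cmp Z (\<lambda>x. entering (l x) (s x))"
  unfolding entering_def by (intro cmp_intros)

lemma cmp_pop [cmp_intros]:
  assumes "cmp Z n" "cmp Z S"
  shows "cmp Z (\<lambda>x. pop (n x) (S x))"
proof -
  have "cmp Z (\<lambda>v. pop_step (n (fst v)) (snd v))"
    unfolding pop_step_def protected_def by (intro cmp_intros cmp_comp[OF assms(1)])
  then show ?thesis unfolding pop_def by (intro cmp_intros assms)
qed

lemma cmp_witness [cmp_intros]:
  assumes "cmp Z l" "cmp Z v"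
  shows "cmp Z (\<lambda>x. witness (l x) (v x))"
  unfolding witness_def by (intro cmp_intros assms cmp_comp[OF assms(2)])

lemma cmp_labels [cmp_intros]:
  assumes "cmp Z S" "cmp Z l" "cmp Z s"
  shows "cmp Z (\<lambda>x. labels c (S x) (l x) (s x))"
  unfolding labels_def acts_def small_def
  by (intro cmp_intros assms cmp_comp[OF assms(1)] cmp_comp[OF assms(2)] cmp_comp[OF assms(3)])

lemma cmp_state [cmp_intros]:
  assumes "cmp Z s"
  shows "cmp Z (\<lambda>x. state c (s x))"
  unfolding state_def stage_def pop_entering_def by (intro cmp_intros assms)

subsection \<open>Popping\<close>

lemma pop_step_suffix: "suffix (pop_step n S) S"
  by (simp add: pop_step_def suffix_tl)

lemma pop_suffix: "suffix (pop n S) S"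
proof -
  have "suffix ((pop_step n ^^ k) S) S" for k
    by (induction k) (auto intro: suffix_order.trans pop_step_suffix)
  then show ?thesis by (simp add: pop_def)
qed

lemma suffix_pop:
  assumes "suffix T S" "length T \<le> n \<or> protected n (hd T)"
  shows "suffix T (pop n S)"
proof -
  have "suffix T (pop_step n U)" if "suffix T U" for U
    using that assms(2) by (cases U) (auto simp: pop_step_def suffix_Cons)
  then have "suffix T ((pop_step n ^^ k) S)" for k
    by (induction k) (simp_all add: assms(1))
  then show ?thesis by (simp add: pop_def)
qed

lemma pop_stops: "length (pop n S) \<le> n \<or> protected n (hd (pop n S))"
proof -
  have step: "pop_step n U = U" if "length U \<le> n \<or> protected n (hd U)" for U
    using that by (auto simp: pop_step_def)
  have step': "length (pop_step n U) < length U" if "\<not> (length U \<le> n \<or> protected n (hd U))" for U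
    using that by (auto simp: pop_step_def)
  have "(length U \<le> n \<or> protected n (hd U)) \<or> length U + k \<le> length S"
    if "U = (pop_step n ^^ k) S" for k U
    using that
  proof (induction k arbitrary: U)
    case (Suc k)
    define V where "V = (pop_step n ^^ k) S"
    then have U: "U = pop_step n V" using Suc.prems by simp
    show ?case
    proof (cases "length V \<le> n \<or> protected n (hd V)")
      case True
      with step U show ?thesis by simp
    next
      case False
      with step'[OF False] Suc.IH[OF V_def] U show ?thesis by simp
    qed
  qed simp
  from this[OF pop_def] show ?thesis by auto
qed

subsection \<open>The sequence of stacks\<close>

context
  fixes c :: prog
begin

definition enum :: "nat \<Rightarrow> nat list" where
  "enum s = snd (state c s)"

definition stack :: "nat \<Rightarrow> stack" where
  "stack s = fst (state c s)"

definition rest :: "nat \<Rightarrow> stack" where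
  "rest s = fst (pop_entering (state c s) s)"

definition label_set :: "nat \<Rightarrow> nat set" where
  "label_set s = {v. v < s \<and> acts c (rest s) (enum (Suc s)) s v}"

definition enters :: "nat \<Rightarrow> nat \<Rightarrow> bool" where
  "enters n s \<longleftrightarrow> entering (enum s) s = Some n"

text \<open>The set D of the theorem. A stage that has left the stack never returns, so one absence
  after it was pushed decides.\<close>

definition removed :: "nat set" where
  "removed = {x. \<exists>s. x < s \<and> x \<notin> set (map fst (stack s))}"

lemma enum_0 [simp]: "enum 0 = []" and stack_0 [simp]: "stack 0 = []"
  by (simp_all add: enum_def stack_def state_def)

lemma state_Suc: "state c (Suc s) = stage c (state c s) s"
  by (simp add: state_def)

lemma enum_Suc: "enum (Suc s) = (case entering (enum s) s of None \<Rightarrow> enum s | Some n \<Rightarrow> n # enum s)"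
  by (simp add: enum_def state_Suc stage_def pop_entering_def split: option.split)

lemma rest_eq: "rest s = (case entering (enum s) s of None \<Rightarrow> stack s | Some n \<Rightarrow> pop n (stack s))"
  by (simp add: rest_def enum_def stack_def pop_entering_def split: option.split)

lemma stack_Suc: "\<exists>L. stack (Suc s) = (s, L) # rest s \<and> set L = label_set s"
  by (auto simp: stack_def rest_def label_set_def enum_def state_Suc stage_def labels_def)

lemma rest_suffix: "suffix (rest s) (stack s)"
  by (auto simp: rest_eq pop_suffix split: option.split)

lemma suffix_rest:
  assumes "suffix T (stack s)" "\<And>n. enters n s \<Longrightarrow> length T \<le> n \<or> protected n (hd T)"
  shows "suffix T (rest s)"
  using assms suffix_pop by (auto simp: rest_eq enters_def split: option.split)

lemma entry_label_set: "E \<in> set (stack s) \<Longrightarrow> fst E < s \<and> set (snd E) = label_set (fst E)"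
proof (induction s)
  case (Suc s)
  with stack_Suc[of s] set_mono_suffix[OF rest_suffix[of s]] show ?case by fastforce
qed simp

lemma stack_less: "x \<in> set (map fst (stack s)) \<Longrightarrow> x < s"
  using entry_label_set by auto

lemma stack_Suc_fst: "set (map fst (stack (Suc s))) = insert s (set (map fst (rest s)))"
  using stack_Suc[of s] by auto

lemma rest_fst: "set (map fst (rest s)) \<subseteq> set (map fst (stack s))"
  using set_mono_suffix[OF rest_suffix[of s]] by auto

lemma distinct_stack: "distinct (map fst (stack s))"
proof (induction s)
  case (Suc s)
  from stack_Suc obtain L where L: "stack (Suc s) = (s, L) # rest s" by blast
  have "distinct (map fst (rest s))"
    using Suc rest_suffix[of s] by (auto simp: suffix_def)
  moreover have "s \<notin> set (map fst (rest s))" using rest_fst stack_less by blast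
  ultimately show ?case using L by simp
qed simp

lemma stack_antimono:
  assumes "x < s" "s \<le> s'" "x \<in> set (map fst (stack s'))"
  shows "x \<in> set (map fst (stack s))"
  using assms(2,3,1)
proof (induction s' rule: dec_induct)
  case (step s')
  then show ?case using rest_fst[of s'] unfolding stack_Suc_fst by auto
qed

text \<open>Only the top of the stack changes, so what lies beneath \<open>r\<close> is frozen while
  \<open>r\<close> remains.\<close>

lemma stack_suffix_stack:
  assumes "r < s" "r \<in> set (map fst (stack s))"
  shows "suffix (stack (Suc r)) (stack s)"
proof -
  from assms(1) have "Suc r \<le> s" by simp
  then show ?thesis using assms(2)
  proof (induction s rule: dec_induct)
    case (step s)
    from step have r: "r \<in> set (map fst (rest s))" unfolding stack_Suc_fst by auto
    with step rest_fst have "suffix (stack (Suc r)) (stack s)" by blast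
    then consider "suffix (stack (Suc r)) (rest s)" | "suffix (rest s) (stack (Suc r))"
      using rest_suffix suffix_same_cases by blast
    then have "suffix (stack (Suc r)) (rest s)"
    proof cases
      case 2
      from stack_Suc obtain L where L: "stack (Suc r) = (r, L) # rest r" by blast
      \<comment> \<open>\<open>rest s\<close> still contains \<open>r\<close>, but all entries of
        \<open>rest r\<close> are smaller.\<close>
      have "\<not> suffix (rest s) (rest r)"
        using r rest_fst[of r] stack_less[of r r] set_mono_suffix[of "rest s" "rest r"] by auto
      with 2 L have "rest s = stack (Suc r)" by (auto simp: suffix_Cons)
      then show ?thesis by simp
    qed
    with stack_Suc[of s] show ?case by (auto simp: suffix_Cons)
  qed simp
qed

text \<open>The entries of a stack are distinct, so the part starting at \<open>r\<close> is unique
  and \<open>stack_suffix_stack\<close> identifies it.\<close>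

lemma suffix_stack_eq:
  assumes "suffix ((r, L) # T) (stack s)"
  shows "(r, L) # T = stack (Suc r)"
proof -
  have r: "r \<in> set (map fst (stack s))" using set_mono_suffix[OF assms] by force
  from stack_Suc obtain L' where L': "stack (Suc r) = (r, L') # rest r" by blast
  from r stack_less stack_suffix_stack have "suffix (stack (Suc r)) (stack s)" by blast
  then obtain U where U: "stack s = U @ (r, L') # rest r" using L' by (auto simp: suffix_def)
  from assms obtain V where V: "stack s = V @ (r, L) # T" by (auto simp: suffix_def)
  have "map fst U @ r # map fst (rest r) = map fst V @ r # map fst T"
    using arg_cong[OF U, of "map fst"] arg_cong[OF V, of "map fst"] by simp
  moreover have "r \<notin> set (map fst U)" "r \<notin> set (map fst (rest r))"
    using distinct_stack[of s, unfolded U] by simp_all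
  ultimately have "map fst U = map fst V"
    by (simp add: append_Cons_eq_iff)
  then have "length U = length V" by (rule map_eq_imp_length_eq)
  with U V L' show ?thesis by auto
qed

lemma suffix_stack_persists:
  assumes "suffix T (stack s0)" "s0 \<le> s1"
    and "\<And>n s. s0 \<le> s \<Longrightarrow> s < s1 \<Longrightarrow> enters n s \<Longrightarrow> length T \<le> n \<or> protected n (hd T)"
  shows "suffix T (stack s1)"
  using assms(2,1,3)
proof (induction s1 rule: dec_induct)
  case (step s)
  then have "suffix T (rest s)" by (intro suffix_rest) auto
  with stack_Suc[of s] show ?case by (auto simp: suffix_Cons)
qed simp

subsection \<open>True stages\<close>

lemma true_stageD:
  assumes "r \<notin> removed" "r < s"
  shows "r \<in> set (map fst (stack s))" "suffix (stack (Suc r)) (stack s)"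
  using assms stack_suffix_stack by (auto simp: removed_def)

lemma true_stageI:
  assumes "\<And>s. s \<ge> s0 \<Longrightarrow> r \<in> set (map fst (stack s))"
  shows "r \<notin> removed"
proof
  assume "r \<in> removed"
  then obtain s where "r < s" "r \<notin> set (map fst (stack s))" by (auto simp: removed_def)
  with stack_antimono[of r s "max s s0"] assms[of "max s s0"] show False by auto
qed

text \<open>Beneath an entry that is never popped nothing is ever popped, so the guess at
  \<open>removed\<close> made at a true stage is final below that stage. With the bound on queries
  this makes runs at true stages correct.\<close>

lemma removed_iff:
  assumes "r \<notin> removed" "x < r"
  shows "x \<in> removed \<longleftrightarrow> x \<in> popped (rest r)"
proof
  assume "x \<in> popped (rest r)"
  with assms(2) have "x \<notin> set (map fst (stack (Suc r)))"
    unfolding stack_Suc_fst popped_def by auto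
  with assms(2) show "x \<in> removed" unfolding removed_def by (auto intro: less_SucI)
next
  assume "x \<in> removed"
  have "x \<notin> set (map fst (rest r))"
  proof
    assume "x \<in> set (map fst (rest r))"
    then have "x \<in> set (map fst (stack (Suc r)))" unfolding stack_Suc_fst by simp
    then have "x \<in> set (map fst (stack s))" if "s \<ge> Suc r" for s
      using true_stageD(2)[OF assms(1), of s] set_mono_suffix that by fastforce
    with true_stageI \<open>x \<in> removed\<close> show False by blast
  qed
  then show "x \<in> popped (rest r)" by (simp add: popped_def)
qed

lemma run_popped: "r \<notin> removed \<Longrightarrow> run (popped (rest r)) r p x = run removed r p x"
  using removed_iff by (intro run_cong) auto

section \<open>Enumeration of the halting problem and growth of the stack\<close>

lemma enum_mono:
  assumes "s \<le> s'"
  shows "suffix (enum s) (enum s')"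
  using assms
proof (induction s' rule: dec_induct)
  case (step s')
  then show ?case by (auto simp: enum_Suc suffix_Cons split: option.split)
qed simp

lemma enters_enum: "enters n s \<Longrightarrow> n \<notin> set (enum s) \<and> enum (Suc s) = n # enum s"
  by (auto simp: enters_def enum_Suc entering_def split: if_splits)

lemma distinct_enum: "distinct (enum s)"
proof (induction s)
  case (Suc s)
  then show ?case using enters_enum[of _ s]
    by (cases "entering (enum s) s") (auto simp: enum_Suc enters_def)
qed simp

lemma enum_enters:
  assumes "n \<in> set (enum s')" "n \<notin> set (enum s)" "s \<le> s'"
  shows "\<exists>q\<ge>s. q < s' \<and> enters n q"
  using assms(3,1,2)
proof (induction s' rule: dec_induct)
  case (step s')
  show ?case
  proof (cases "n \<in> set (enum s')")
    case False
    with step.prems have "enters n s'" by (auto simp: enum_Suc enters_def split: option.splits)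
    with step.hyps show ?thesis by auto
  qed (use step less_SucI in blast)
qed simp

lemma enters_unique: "enters n s \<Longrightarrow> enters n s' \<Longrightarrow> s = s'"
proof (induction s s' rule: linorder_wlog)
  case (le s s')
  show ?case
  proof (rule ccontr)
    assume "s \<noteq> s'"
    with le have "suffix (enum (Suc s)) (enum s')" by (intro enum_mono) simp
    with le enters_enum show False by (metis list.set_intros(1) set_mono_suffix subsetD)
  qed
qed simp

text \<open>Each of the finitely many numbers below \<open>n0\<close> enters at most once.\<close>

lemma no_entering_below: "\<exists>s0. \<forall>s\<ge>s0. \<forall>n. enters n s \<longrightarrow> n0 \<le> n"
proof -
  have "finite {s. enters n s}" for n
    by (rule finite_subset[of _ "{SOME s. enters n s}"]) (auto intro: enters_unique someI)
  then have "finite (\<Union>n<n0. {s. enters n s})" by blast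
  then obtain s0 where s0: "\<forall>s\<in>(\<Union>n<n0. {s. enters n s}). s < s0"
    using finite_nat_set_iff_bounded by meson
  then have "\<forall>s\<ge>s0. \<forall>n. enters n s \<longrightarrow> n0 \<le> n"
    by (metis UN_iff lessThan_iff mem_Collect_eq not_le)
  then show ?thesis ..
qed

lemma length_rest: "enters n s \<Longrightarrow> min n (length (stack s)) \<le> length (rest s)"
proof -
  define T where "T = drop (length (stack s) - n) (stack s)"
  assume "enters n s"
  moreover have "length T = min n (length (stack s))" by (auto simp: T_def)
  moreover from this have "suffix T (pop n (stack s))"
    by (intro suffix_pop) (auto simp: T_def suffix_drop)
  ultimately show ?thesis using suffix_length_le[of T "rest s"] by (auto simp: rest_eq enters_def)
qed

text \<open>Once only numbers from \<open>L\<close> on enter, a stack lower than \<open>L\<close> is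
  not popped at all and a higher one not below \<open>L\<close>. Each stage pushes an entry, so the
  height grows until it reaches \<open>L\<close>.\<close>

lemma length_stack_unbounded: "\<exists>s1. \<forall>s\<ge>s1. L \<le> length (stack s)"
proof -
  obtain s0 where s0: "\<And>s n. s \<ge> s0 \<Longrightarrow> enters n s \<Longrightarrow> L \<le> n"
    using no_entering_below by blast
  have "min L k \<le> length (stack (s0 + k))" for k
  proof (induction k)
    case (Suc k)
    from stack_Suc have len: "length (stack (Suc (s0 + k))) = Suc (length (rest (s0 + k)))"
      by (metis length_Cons)
    show ?case
    proof (cases "\<exists>n. enters n (s0 + k)")
      case True
      then show ?thesis using length_rest[of _ "s0 + k"] s0[of "s0 + k"] len Suc by fastforce
    next
      case False
      then have "rest (s0 + k) = stack (s0 + k)" by (auto simp: rest_eq enters_def split: option.splits)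
      with len Suc show ?thesis by simp
    qed
  qed simp
  from this[of "s - s0" for s] have "\<forall>s\<ge>s0 + L. L \<le> length (stack s)"
    by (metis add_leD1 add_diff_inverse_nat le_diff_conv2 min.absorb1 not_le add.commute)
  then show ?thesis ..
qed

text \<open>Otherwise let \<open>L\<close> be one more than their number: once the height is at
  least \<open>L\<close> and only numbers from \<open>L\<close> on enter, the lowest
  \<open>L\<close> entries stay forever.\<close>

lemma infinite_true_stages: "infinite (- removed)"
proof
  assume fin: "finite (- removed)"
  define L where "L = Suc (card (- removed))"
  obtain s0 where s0: "\<And>s n. s \<ge> s0 \<Longrightarrow> enters n s \<Longrightarrow> L \<le> n"
    using no_entering_below by blast
  obtain s1 where s1: "\<And>s. s \<ge> s1 \<Longrightarrow> L \<le> length (stack s)"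
    using length_stack_unbounded by blast
  define m where "m = max s0 s1"
  define T where "T = drop (length (stack m) - L) (stack m)"
  have len: "length T = L" using s1[of m] by (simp add: T_def m_def)
  have suf: "suffix T (stack s)" if "s \<ge> m" for s
    by (rule suffix_stack_persists[of _ m])
      (use that s0 len in \<open>auto simp: T_def suffix_drop m_def\<close>)
  have "x \<notin> removed" if "x \<in> set (map fst T)" for x
    by (rule true_stageI[of m]) (use that set_mono_suffix[OF suf] in auto)
  then have "card (set (map fst T)) \<le> card (- removed)"
    using fin by (intro card_mono) auto
  moreover have "distinct (map fst T)"
    using distinct_stack[of m] suf[of m] by (auto simp: suffix_def)
  then have "card (set (map fst T)) = L" using len by (metis distinct_card length_map)
  ultimately show False by (simp add: L_def)
qed

lemma true_stage_above: "\<exists>r\<ge>m. r \<notin> removed"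
  using infinite_true_stages unfolding infinite_nat_iff_unbounded_le by auto

lemma label_true_stage:
  assumes "v \<in> label_set r" "\<And>n s. r < s \<Longrightarrow> enters n s \<Longrightarrow> threshold v \<le> n"
  shows "r \<notin> removed"
proof (rule true_stageI[of "Suc r"])
  fix s assume s: "Suc r \<le> s"
  from stack_Suc obtain L where L: "stack (Suc r) = (r, L) # rest r" "set L = label_set r" by blast
  have prot: "protected n (hd (stack (Suc r)))" if "Suc r \<le> s'" "enters n s'" for n s'
    using assms(1) assms(2)[of s' n] that L by (auto simp: protected_def)
  have "suffix (stack (Suc r)) (stack s)"
    by (rule suffix_stack_persists[OF _ s]) (use prot in auto)
  from set_mono_suffix[OF this] L show "r \<in> set (map fst (stack s))" by force
qed

subsection \<open>Incompleteness\<close>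

text \<open>The c.e. set A that the functionals fail to compute. A witness stays in it even if its
  label is popped, hence the fresh witnesses for injured labels.\<close>

definition target :: "nat set" where
  "target = {w. \<exists>r. \<exists>v\<in>label_set r. w = witness (enum (Suc r)) v}"

text \<open>The oracle below a true stage is final, so the output 0 persists although the witness
  has been enumerated: a permanent disagreement.\<close>

lemma true_label:
  assumes "r \<notin> removed" "v \<in> label_set r"
  shows "computes removed (prog_of (index v)) (witness (enum (Suc r)) v) 0"
    "witness (enum (Suc r)) v \<in> target"
proof -
  from assms(2) have "run removed r (prog_of (index v)) (witness (enum (Suc r)) v) = Some 0"
    using run_popped[OF assms(1)] by (auto simp: label_set_def acts_def)
  then show "computes removed (prog_of (index v)) (witness (enum (Suc r)) v) 0"
    by (rule run_sound)
  show "witness (enum (Suc r)) v \<in> target" using assms(2) by (auto simp: target_def)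
qed

lemma rest_true_stage:
  assumes "r \<notin> removed" "E \<in> set (rest r)"
  shows "fst E \<notin> removed" "set (snd E) = label_set (fst E)"
proof -
  have E: "E \<in> set (stack r)" using assms(2) set_mono_suffix[OF rest_suffix[of r]] by auto
  then show "set (snd E) = label_set (fst E)" using entry_label_set by blast
  from assms(2) have "fst E \<notin> popped (rest r)" by (simp add: popped_def)
  with removed_iff[OF assms(1)] entry_label_set[OF E] show "fst E \<notin> removed" by blast
qed

text \<open>If \<open>q\<close> computes \<open>target\<close>, no label of its index can sit at a
  true stage; yet a label with a suitable threshold and a settled witness \<open>w\<close> gets
  attached at one.\<close>

lemma target_not_computed:
  assumes cost: "\<And>i. \<exists>p. \<forall>m n. p \<le> fst (prod_decode m) \<longrightarrow> computes removed c m n \<longrightarrow> small i n"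
    and q: "\<And>w. computes removed q w (if w \<in> target then 1 else 0)"
  shows False
proof -
  obtain i where i: "prog_of i = q" using prog_of_surj by blast
  obtain p where p: "\<And>m n. p \<le> fst (prod_decode m) \<Longrightarrow> computes removed c m n \<Longrightarrow> small i n"
    using cost by blast
  define v where "v = prod_encode (i, p)"
  have v: "index v = i" "threshold v = p" by (simp_all add: v_def)
  have no_label: False if "r \<notin> removed" "u \<in> label_set r" "index u = i" for r u
    using true_label[OF that(1,2)] q computes_det i that(3) by fastforce
  obtain s0 where s0: "\<And>s n. s \<ge> s0 \<Longrightarrow> enters n s \<Longrightarrow> p \<le> n"
    using no_entering_below by blast
  define count where "count s = length (filter (\<lambda>n. n < p) (enum s))" for s
  have witness: "witness (enum s) v = prod_encode (v, count s)" for s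
    by (simp add: witness_def count_def v)
  have count_mono: "count s \<le> count s'" if "s \<le> s'" for s s'
    using enum_mono[OF that] by (auto simp: suffix_def count_def)
  have count_Suc: "count (Suc s) = (if \<exists>n<p. enters n s then Suc (count s) else count s)" for s
    by (auto simp: count_def enum_Suc enters_def split: option.splits)
  have count_const: "count s = count s0" if "s \<ge> s0" for s
    using that by (induction s rule: dec_induct) (use s0 in \<open>auto simp: count_Suc not_le[symmetric]\<close>)
  define w where "w = witness (enum s0) v"
  \<comment> \<open>A label that put \<open>w\<close> into \<open>target\<close> was attached when
    the count already had its final value, so no number below \<open>p\<close> enters afterwards. It
    would never be injured, and its stage would be true.\<close>
  have "w \<notin> target"
  proof
    assume "w \<in> target"
    then obtain r u where u: "u \<in> label_set r" "w = witness (enum (Suc r)) u"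
      by (auto simp: target_def)
    then have uv: "u = v" by (auto simp: w_def witness_def)
    with u have eq: "count (Suc r) = count s0" by (simp add: w_def witness)
    have "p \<le> n" if "r < s" "enters n s" for n s
    proof (rule ccontr)
      assume n: "\<not> p \<le> n"
      with s0 that(2) have "s < s0" by (meson not_le)
      have "count (Suc r) < count (Suc s)"
        using count_mono[of "Suc r" s] that n by (auto simp: count_Suc not_le)
      also have "\<dots> \<le> count s0" using \<open>s < s0\<close> by (intro count_mono) simp
      finally show False using eq by simp
    qed
    then have "r \<notin> removed" using label_true_stage[of v r] u uv v by blast
    with no_label u uv v show False by blast
  qed
  with q have "computes removed q w 0" by (metis (full_types))
  then obtain B where B: "\<And>b. b \<ge> B \<Longrightarrow> run removed b q w = Some 0"
    using run_complete by blast
  \<comment> \<open>Late enough that the run on \<open>w\<close> has converged to 0, the witness is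
    settled and \<open>v\<close> is below the stage.\<close>
  obtain r where r: "r \<ge> max s0 (max B (Suc v))" "r \<notin> removed"
    using true_stage_above by blast
  have "v \<in> label_set r"
    unfolding label_set_def acts_def run_popped[OF r(2)] mem_Collect_eq
  proof (intro conjI)
    show "v < r" using r by simp
    \<comment> \<open>A competing label on this stack would itself belong to a true stage, where
      none of index \<open>i\<close> exists.\<close>
    show "\<not> (\<exists>E\<in>set (rest r). \<exists>u\<in>set (snd E). index u = index v)"
      using rest_true_stage[OF r(2)] no_label v by metis
    have "witness (enum (Suc r)) v = w"
      unfolding w_def witness using count_const[of "Suc r"] r by simp
    with B[of r] r v i show "run removed r (prog_of (index v)) (witness (enum (Suc r)) v) \<noteq> None"
      "the (run removed r (prog_of (index v)) (witness (enum (Suc r)) v)) = 0"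
      by simp_all
    show "\<forall>m<r. threshold v \<le> fst (prod_decode m) \<longrightarrow>
      run removed r c m = None \<or> small (index v) (the (run removed r c m))"
      using p[OF _ run_sound] v by (metis option.exhaust_sel)
  qed
  with no_label r v show False by blast
qed

subsection \<open>The approximation\<close>

text \<open>A change at \<open>x < Suc t\<close> from \<open>approx t\<close> to
  \<open>approx (Suc t)\<close> is charged the cost of \<open>x\<close> at \<open>Suc t\<close>. The
  code of this argument must also lie below \<open>r\<close>, because \<open>acts\<close> tests only
  such arguments at stage \<open>r\<close>.\<close>

definition converged :: "nat \<Rightarrow> nat \<Rightarrow> bool" where
  "converged t r \<longleftrightarrow> r \<notin> removed \<and>
    (\<forall>x<Suc t. prod_encode (x, Suc t) < r \<and> run removed r c (prod_encode (x, Suc t)) \<noteq> None)"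

definition speed :: "nat \<Rightarrow> nat" where
  "speed t = rec_nat (LEAST r. converged 0 r) (\<lambda>n r'. LEAST r. r' < r \<and> converged (Suc n) r) t"

definition approx :: "nat \<Rightarrow> nat set" where
  "approx t = set (enum (Suc (speed t)))"

context
  assumes total: "\<And>m. \<exists>n. computes removed c m n"
begin

lemma converged_above: "\<exists>r>m. converged t r"
proof -
  have "\<exists>B. \<forall>b\<ge>B. run removed b c k \<noteq> None" for k
    using total[of k] run_complete by fastforce
  then obtain B where B: "\<And>k b. b \<ge> B k \<Longrightarrow> run removed b c k \<noteq> None" by metis
  \<comment> \<open>A sum that exceeds \<open>m\<close>, all the argument codes and all the bounds
    for convergence.\<close>
  define N where "N = Suc m + (\<Sum>x<Suc t. Suc (prod_encode (x, Suc t) + B (prod_encode (x, Suc t))))"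
  obtain r where r: "r \<ge> N" "r \<notin> removed" using true_stage_above by blast
  have "Suc (prod_encode (x, Suc t) + B (prod_encode (x, Suc t))) \<le> N" if "x < Suc t" for x
    unfolding N_def using that
    by (intro trans_le_add2 member_le_sum[of x "{..<Suc t}"
      "\<lambda>x. Suc (prod_encode (x, Suc t) + B (prod_encode (x, Suc t)))"]) auto
  then have "prod_encode (x, Suc t) < r \<and> B (prod_encode (x, Suc t)) \<le> r" if "x < Suc t" for x
    using that r(1) by fastforce
  with r(2) B have "converged t r" by (simp add: converged_def)
  moreover have "m < r" using r by (simp add: N_def)
  ultimately show ?thesis by blast
qed

lemma speed_less_Suc: "speed t < speed (Suc t)" and converged_speed: "converged t (speed t)"
proof -
  have "\<exists>r. r' < r \<and> converged (Suc t) r" for r' t using converged_above by blast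
  then have *: "speed t < speed (Suc t) \<and> converged (Suc t) (speed (Suc t))" for t
    unfolding speed_def using LeastI_ex[of "\<lambda>r. _ < r \<and> converged (Suc t) r"] by simp
  then show "speed t < speed (Suc t)" by blast
  have "converged 0 (speed 0)"
    unfolding speed_def using LeastI_ex[of "converged 0"] converged_above by auto
  with * show "converged t (speed t)" by (cases t) auto
qed

lemma speed_strict_mono: "t < t' \<Longrightarrow> speed t < speed t'"
  using strict_mono_Suc_iff[of speed] speed_less_Suc by (auto simp: strict_mono_def)

lemma speed_true: "speed t \<notin> removed"
  using converged_speed by (auto simp: converged_def)

lemma cmp_speed: "cmp removed speed"
proof -
  have q: "cmp removed (\<lambda>v. converged (f v) (g v))"
    if "cmp removed f" "cmp removed g" for f g :: "'a::encodable \<Rightarrow> nat"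
  proof -
    have "cmp removed (\<lambda>v. run removed (b v) c (x v))"
      if "cmp removed b" "cmp removed x" for b x :: "'b::encodable \<Rightarrow> nat"
      by (rule cmp_run) (intro cmp_intros that)+
    then show ?thesis unfolding converged_def
      by (intro cmp_intros that cmp_comp[OF that(1)] cmp_comp[OF that(2)])
  qed
  have "cmp removed (\<lambda>t. rec_nat (LEAST r. converged 0 r)
      (\<lambda>n r'. LEAST r. r' < r \<and> converged (Suc n) r) t)"
    using converged_above by (intro cmp_intros q) auto
  then show ?thesis by (simp add: speed_def[abs_def])
qed

text \<open>Each of the true stages \<open>speed 0\<close>, ..., \<open>speed t\<close> stays on the
  stack. This height rules out that a popping due to some \<open>n <= t\<close> ends for lack of
  entries.\<close>

lemma length_stack_speed: "Suc t \<le> length (stack (Suc (speed t)))"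
proof (induction t)
  case 0
  then show ?case using stack_Suc[of "speed 0"] by auto
next
  case (Suc t)
  have "suffix (stack (Suc (speed t))) (stack (Suc (speed (Suc t))))"
    using true_stageD(2)[OF speed_true, of t] speed_less_Suc[of t] by simp
  moreover have "stack (Suc (speed t)) \<noteq> stack (Suc (speed (Suc t)))"
    using stack_Suc[of "speed t"] stack_Suc[of "speed (Suc t)"] speed_less_Suc[of t] by auto
  ultimately have "length (stack (Suc (speed t))) < length (stack (Suc (speed (Suc t))))"
    by (metis suffix_def append_Nil length_append less_add_same_cancel2 length_greater_0_conv)
  with Suc show ?case by simp
qed

lemma approx_change:
  assumes n: "n < Suc t" "(n \<in> approx t) \<noteq> (n \<in> approx (Suc t))"
    and least: "\<And>k. (k \<in> approx t) \<noteq> (k \<in> approx (Suc t)) \<Longrightarrow> n \<le> k"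
  shows "\<exists>r v. speed t \<le> r \<and> r < speed (Suc t) \<and> r \<notin> removed \<and> v \<in> label_set r \<and>
    (\<forall>k. computes removed c (prod_encode (n, Suc t)) k \<longrightarrow> small (index v) k)"
proof -
  let ?s = "speed t" and ?s' = "speed (Suc t)"
  have less: "?s < ?s'" by (rule speed_less_Suc)
  have sub: "approx t \<subseteq> approx (Suc t)"
    unfolding approx_def using less by (intro set_mono_suffix enum_mono) simp
  \<comment> \<open>Every number that enters between the two stages is a change, hence at least the
    least change \<open>n\<close>.\<close>
  have changed: "n \<le> k" if "enters k q" "?s < q" "q \<le> ?s'" for k q
  proof -
    have "suffix (enum (Suc q)) (enum (Suc ?s'))" "suffix (enum (Suc ?s)) (enum q)"
      using that by (auto intro: enum_mono)
    then have "k \<in> approx (Suc t)" "k \<notin> approx t"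
      using enters_enum[OF that(1)] set_mono_suffix unfolding approx_def by fastforce+
    then show ?thesis using least by blast
  qed
  from n sub have "n \<in> set (enum (Suc ?s'))" "n \<notin> set (enum (Suc ?s))" by (auto simp: approx_def)
  from enum_enters[OF this] less obtain q where q: "enters n q" "?s < q" "q \<le> ?s'"
    by (auto simp: Suc_le_eq less_Suc_eq_le)
  from stack_Suc obtain L where L: "stack (Suc q) = (q, L) # rest q" by blast
  from stack_Suc obtain L' where L': "stack (Suc ?s) = (?s, L') # rest ?s" by blast
  have "suffix (stack (Suc ?s)) (stack (Suc q))"
    using true_stageD(2)[OF speed_true, of t "Suc q"] q by simp
  with L L' q(2) have suf: "suffix (stack (Suc ?s)) (rest q)" by (auto simp: suffix_Cons)
  then have "n < length (rest q)"
    using suffix_length_le length_stack_speed[of t] n(1) by fastforce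
  \<comment> \<open>The part up to the true stage \<open>?s\<close> is higher than \<open>n\<close>,
    so only a label can have stopped the popping.\<close>
  with q(1) have prot: "protected n (hd (rest q))"
    using pop_stops[of n "stack q"] by (auto simp: rest_eq enters_def)
  from \<open>n < length (rest q)\<close> obtain r M T where rM: "rest q = (r, M) # T"
    by (cases "rest q") auto
  then have r: "rest q = stack (Suc r)"
    using suffix_stack_eq[of r M T q] rest_suffix[of q] by simp
  have r': "r \<in> set (map fst (stack q))"
    using rM rest_fst[of q] by auto
  have "?s \<in> set (map fst (stack (Suc r)))"
    using set_mono_suffix[OF suf] L' r by force
  then have "?s \<le> r" using stack_less by fastforce
  have "r < ?s'" using stack_less[OF r'] q(3) by simp
  have M: "set M = label_set r"
    using entry_label_set[of "(r, M)" "Suc r"] rM r by (metis fst_conv list.set_intros(1) snd_conv)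
  with prot rM obtain v where v: "v \<in> label_set r" "threshold v \<le> n"
    by (auto simp: protected_def)
  \<comment> \<open>Up to \<open>?s'\<close> only numbers from \<open>n\<close> on enter, and the
    label of threshold at most \<open>n\<close> stops them; from then on the entry lies on the stack
    of a true stage.\<close>
  have suf': "suffix (stack (Suc r)) (stack (Suc ?s'))"
  proof (rule suffix_stack_persists[of _ "Suc q"])
    show "suffix (stack (Suc r)) (stack (Suc q))" using L r by (simp add: suffix_Cons)
    show "Suc q \<le> Suc ?s'" using q by simp
    fix k s assume "Suc q \<le> s" "s < Suc ?s'" "enters k s"
    with changed[of k s] q have "n \<le> k" by simp
    with v have "protected k (hd (stack (Suc r)))"
      using rM r M by (metis list.sel(1) protected_def snd_conv le_trans)
    then show "length (stack (Suc r)) \<le> k \<or> protected k (hd (stack (Suc r)))" ..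
  qed
  have "r \<notin> removed"
  proof (rule true_stageI[of "Suc ?s'"])
    fix s assume "Suc ?s' \<le> s"
    then have "suffix (stack (Suc ?s')) (stack s)"
      using true_stageD(2)[OF speed_true, of "Suc t" s] by simp
    with suf' have "suffix (stack (Suc r)) (stack s)" by (rule suffix_order.trans)
    then show "r \<in> set (map fst (stack s))"
      using set_mono_suffix[of "stack (Suc r)" "stack s"] stack_Suc_fst[of r] by fastforce
  qed
  \<comment> \<open>As \<open>?s\<close> is at most \<open>r\<close>, this cost had converged by
    stage \<open>r\<close> and its argument is below \<open>r\<close>, so it was tested when
    \<open>v\<close> was attached.\<close>
  moreover have "small (index v) k" if k: "computes removed c (prod_encode (n, Suc t)) k" for k
  proof -
    let ?m = "prod_encode (n, Suc t)"
    from converged_speed[of t] n(1) obtain k' where k': "?m < ?s" "run removed ?s c ?m = Some k'"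
      by (auto simp: converged_def)
    with \<open>?s \<le> r\<close> have "?m < r" "run removed r c ?m = Some k'" by (auto intro: run_mono)
    moreover have "k' = k" using run_sound[OF k'(2)] k computes_det by blast
    ultimately show ?thesis
      using v run_popped[OF \<open>r \<notin> removed\<close>] by (auto simp: label_set_def acts_def)
  qed
  ultimately show ?thesis using \<open>?s \<le> r\<close> \<open>r < ?s'\<close> v(1) by blast
qed

text \<open>The true stage \<open>r\<close> is still on the stack at stage \<open>r'\<close>, so its
  indices are occupied.\<close>

lemma true_labels_distinct:
  assumes "r \<notin> removed" "r' \<notin> removed" "r < r'" "v \<in> label_set r" "v' \<in> label_set r'"
  shows "index v \<noteq> index v'"
proof -
  have "r \<notin> popped (rest r')" using removed_iff[OF assms(2,3)] assms(1) by blast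
  then obtain E where E: "E \<in> set (rest r')" "fst E = r" by (auto simp: popped_def)
  with rest_true_stage[OF assms(2)] assms(4) have "v \<in> set (snd E)" by blast
  with assms(5) E show ?thesis by (auto simp: label_set_def acts_def)
qed

end

end

section \<open>The theorem\<close>

lemma cmp_stack: "cmp Z s \<Longrightarrow> cmp Z (\<lambda>x. stack c (s x))"
  unfolding stack_def by (intro cmp_intros)

lemma cmp_enum: "cmp Z s \<Longrightarrow> cmp Z (\<lambda>x. enum c (s x))"
  unfolding enum_def by (intro cmp_intros)

lemma ce_removed: "ce (removed c)"
proof -
  have "cmp {} (\<lambda>v. fst v < snd v \<and> fst v \<notin> set (map fst (stack c (snd v))))"
    by (intro cmp_intros cmp_stack)
  then show ?thesis unfolding removed_def by (rule ce_exists)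
qed

lemma set_enum_iff: "(\<exists>s. n \<in> set (enum c s)) \<longleftrightarrow> n \<in> halting_problem"
proof
  have "set (enum c s) \<subseteq> halting_problem" for s
  proof (induction s)
    case (Suc s)
    have "n \<in> halting_problem" if "entering (enum c s) s = Some n" for n
      using that run_sound
      by (fastforce simp: entering_def halting_problem_def split: if_splits)
    with Suc show ?case by (auto simp: enum_Suc split: option.split)
  qed simp
  then show "\<exists>s. n \<in> set (enum c s) \<Longrightarrow> n \<in> halting_problem" by blast
next
  assume "n \<in> halting_problem"
  then obtain p y where p: "n = prog_code p" "computes {} p n y" by (auto simp: halting_problem_def)
  obtain i where i: "prog_of i = p" using prog_of_surj by blast
  from run_complete[OF p(2)] obtain b where b: "run {} b p n = Some y" by blast
  define s where "s = prod_encode (i, b)"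
  have "n \<in> set (enum c (Suc s))"
    using b i p(1) by (auto simp: enum_Suc entering_def s_def split: option.split)
  then show "\<exists>s. n \<in> set (enum c s)" ..
qed

text \<open>The program \<open>f x\<close> discards its input and runs \<open>p\<close> on the
  constant \<open>x\<close>, so it halts on its own code iff \<open>p\<close> halts on
  \<open>x\<close>.\<close>

lemma many_one_halting_problem:
  fixes P :: "nat \<Rightarrow> nat \<Rightarrow> bool"
  assumes "cmp {} (\<lambda>v. P (fst v) (snd v))"
  shows "\<exists>f :: nat \<Rightarrow> prog. (\<forall>Z. cmp Z f) \<and>
    (\<forall>x. prog_code (f x) \<in> halting_problem \<longleftrightarrow> (\<exists>n. P x n))"
proof -
  from ce_exists[OF assms] obtain p where p: "\<And>x. (\<exists>n. P x n) \<longleftrightarrow> (\<exists>y. computes {} p x y)"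
    unfolding ce_def by blast
  define f where "f x = PComp p (const_prog x)" for x
  have "const_prog x = rec_nat PZero (\<lambda>_ r. PComp PSucc r) x" for x
    by (induction x) auto
  then have "cmp Z f" for Z
    unfolding f_def[abs_def] by (auto intro!: cmp_intros)
  moreover have "prog_code (f x) \<in> halting_problem \<longleftrightarrow> (\<exists>n. P x n)" for x
  proof -
    have "(\<exists>y. computes {} (f x) z y) \<longleftrightarrow> (\<exists>y. computes {} p x y)" for z
      unfolding f_def using computes_const_prog cComp computes_det computes_elims(7) by metis
    moreover have "prog_code (f x) \<in> halting_problem \<longleftrightarrow> (\<exists>y. computes {} (f x) (prog_code (f x)) y)"
      using inj_prog_code by (auto simp: halting_problem_def inj_eq)
    ultimately show ?thesis using p by simp
  qed
  ultimately show ?thesis by blast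
qed

lemma removed_incomplete:
  assumes "\<And>i. \<exists>p. \<forall>m n. p \<le> fst (prod_decode m) \<longrightarrow> computes (removed c) c m n \<longrightarrow> small i n"
  shows "\<not> halting_problem \<le>\<^sub>T removed c"
proof
  assume le: "halting_problem \<le>\<^sub>T removed c"
  \<comment> \<open>The labels of stage \<open>r\<close> are those of the top entry of
    \<open>stack c (Suc r)\<close>, so this decidable predicate defines \<open>target\<close> by one
    existential quantifier.\<close>
  define P where "P w r \<longleftrightarrow>
    (\<exists>v\<in>set (snd (hd (stack c (Suc r)))). w = witness (enum c (Suc r)) v)" for w r
  have "cmp {} (\<lambda>v. P (fst v) (snd v))"
    unfolding P_def by (intro cmp_intros cmp_stack cmp_enum)
  from many_one_halting_problem[OF this] obtain f where f: "\<forall>Z. cmp Z f"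
    "\<forall>x. prog_code (f x) \<in> halting_problem \<longleftrightarrow> (\<exists>n. P x n)" by (elim exE conjE)
  have "set (snd (hd (stack c (Suc r)))) = label_set c r" for r
    using stack_Suc[of c r] by (elim exE conjE) simp
  then have target: "w \<in> target c \<longleftrightarrow> (\<exists>r. P w r)" for w
    by (auto simp: P_def target_def)
  have "cmp (removed c) (\<lambda>x. if x \<in> halting_problem then 1 else 0 :: nat)"
    using le by (simp add: turing_le_def cmp_computable_in)
  from cmp_comp[OF this, of "\<lambda>w. prog_code (f w)"] f(1)
  have "cmp (removed c) (\<lambda>w. if prog_code (f w) \<in> halting_problem then 1 else 0 :: nat)"
    by (simp add: cmp_prog_code)
  then have "cmp (removed c) (\<lambda>w. if w \<in> target c then 1 else 0 :: nat)"
    by (simp add: f(2) target)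
  then obtain q where "\<And>w. computes (removed c) q w (if w \<in> target c then 1 else 0)"
    unfolding cmp_def by auto
  with target_not_computed assms show False by blast
qed

lemma cmp_set_encode:
  assumes "cmp Z l" "\<And>x. distinct (l x)"
  shows "cmp Z (\<lambda>x. set_encode (set (l x)))"
proof -
  have "foldl (\<lambda>a y. a + 2 ^ y) b m = b + set_encode (set m)" if "distinct m" for b :: nat and m
    using that by (induction m arbitrary: b) (auto simp: set_encode_insert)
  moreover have "cmp Z (\<lambda>x. foldl (\<lambda>a y. a + 2 ^ y) (0::nat) (l x))"
    by (intro cmp_intros assms)
  ultimately show ?thesis using assms(2) by simp
qed

lemma approximation_approx:
  assumes total: "\<And>m. \<exists>n. computes (removed c) c m n"
  shows "approximation (removed c) halting_problem (approx c)"
  unfolding approximation_def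
proof (intro conjI allI)
  show "finite (approx c s)" for s by (simp add: approx_def)
  have "cmp (removed c) (\<lambda>t. set_encode (approx c t))"
    unfolding approx_def
    by (intro cmp_set_encode cmp_enum distinct_enum cmp_Suc cmp_speed[OF total])
  then show "computable_in (removed c) (\<lambda>s. set_encode (approx c s))"
    by (simp add: cmp_computable_in)
  show "\<forall>\<^sub>F t in sequentially. x \<in> approx c t \<longleftrightarrow> x \<in> halting_problem" for x
  proof (cases "x \<in> halting_problem")
    case True
    then obtain s where s: "x \<in> set (enum c s)" using set_enum_iff by blast
    have "strict_mono (speed c)" using speed_strict_mono[OF total] by (auto simp: strict_mono_def)
    then have "t \<le> speed c t" for t by (rule strict_mono_imp_increasing)
    then have "x \<in> approx c t" if "t \<ge> s" for t
      using s set_mono_suffix[OF enum_mono[of s "Suc (speed c t)" c]] that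
      unfolding approx_def by (meson le_SucI le_trans subsetD)
    with True show ?thesis unfolding eventually_sequentially by blast
  next
    case False
    then show ?thesis using set_enum_iff unfolding approx_def by (intro always_eventually) blast
  qed
qed

lemma small_iff: "small i n \<longleftrightarrow> real_of_rat (rat_of_code n) \<le> (1/2) ^ i"
proof -
  obtain a b where n: "prod_decode n = (a, b)" by force
  have "small i n \<longleftrightarrow> real (a * 2 ^ i) \<le> real (Suc b)"
    unfolding of_nat_le_iff by (simp add: small_def n)
  also have "\<dots> \<longleftrightarrow> real a / real (Suc b) \<le> (1/2) ^ i" by (simp add: field_simps)
  finally show ?thesis by (simp add: rat_of_code_def n of_rat_divide of_rat_add)
qed

text \<open>
  Every nonzero cost is charged to the label found in \<open>approx_change\<close>; a label of index \<open>i\<close> pays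
  for at most one stage.
\<close>

lemma summable_stage_cost:
  assumes total: "\<And>m. \<exists>n. computes (removed c) c m n"
    and f: "\<And>x t. \<exists>n. computes (removed c) c (prod_encode (x, t)) n \<and> f x t = rat_of_code n"
  shows "summable (\<lambda>s. real_of_rat (stage_cost f (approx c) (Suc s)))"
proof -
  let ?g = "\<lambda>s. real_of_rat (stage_cost f (approx c) (Suc s))"
  let ?X = "{t. ?g t \<noteq> 0}"
  have "\<exists>r v. speed c t \<le> r \<and> r < speed c (Suc t) \<and> r \<notin> removed c \<and> v \<in> label_set c r \<and>
      ?g t \<le> (1/2) ^ index v" if "t \<in> ?X" for t
  proof -
    define ch where "ch x \<longleftrightarrow> (x \<in> approx c t) \<noteq> (x \<in> approx c (Suc t))" for x
    define n where "n = (LEAST x. ch x)"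
    from that obtain x where x: "x < Suc t" "ch x"
      by (auto simp: stage_cost_def ch_def split: if_splits)
    then have n: "ch n" "\<And>k. ch k \<Longrightarrow> n \<le> k" unfolding n_def by (auto intro: LeastI Least_le)
    with x have "n < Suc t" by (meson le_less_trans)
    from approx_change[OF total this] n obtain r v where rv: "speed c t \<le> r" "r < speed c (Suc t)"
      "r \<notin> removed c" "v \<in> label_set c r"
      "\<And>k. computes (removed c) c (prod_encode (n, Suc t)) k \<Longrightarrow> small (index v) k"
      unfolding ch_def by blast
    from x have "stage_cost f (approx c) (Suc t) = f n (Suc t)"
      by (auto simp: stage_cost_def ch_def n_def)
    with f[of n "Suc t"] rv(5) small_iff have "?g t \<le> (1/2) ^ index v" by metis
    with rv show ?thesis by blast
  qed
  then obtain r v where rv: "\<And>t. t \<in> ?X \<Longrightarrow> speed c t \<le> r t \<and> r t < speed c (Suc t) \<and>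
      r t \<notin> removed c \<and> v t \<in> label_set c (r t) \<and> ?g t \<le> (1/2) ^ index (v t)"
    by metis
  \<comment> \<open>The half-open intervals from \<open>speed c t\<close> to
    \<open>speed c (Suc t)\<close> are disjoint, so different steps are charged to different true
    stages.\<close>
  have less: "index (v t) \<noteq> index (v t')" if "t \<in> ?X" "t' \<in> ?X" "t < t'" for t t'
  proof -
    have "speed c (Suc t) \<le> speed c t'"
      using that speed_strict_mono[OF total, of "Suc t" t'] by (cases "Suc t = t'") auto
    with rv[OF that(1)] rv[OF that(2)] have "r t < r t'" by linarith
    with rv[OF that(1)] rv[OF that(2)] show ?thesis by (intro true_labels_distinct[OF total]) auto
  qed
  then have inj: "inj_on (\<lambda>t. index (v t)) ?X"
    by (intro inj_onI) (metis linorder_neqE_nat)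
  have nonneg: "0 \<le> ?g t" for t
  proof -
    have "0 \<le> f x t" for x t using f[of x t] rat_of_code_nonneg by metis
    then show ?thesis by (simp add: stage_cost_def)
  qed
  show ?thesis
  proof (rule summableI_nonneg_bounded[OF nonneg])
    fix N
    have "(\<Sum>t<N. ?g t) = (\<Sum>t\<in>?X \<inter> {..<N}. ?g t)"
      by (rule sum.mono_neutral_right) auto
    also have "\<dots> \<le> (\<Sum>t\<in>?X \<inter> {..<N}. (1/2) ^ index (v t))"
      using rv by (intro sum_mono) auto
    also have "\<dots> = sum ((^) (1/2)) ((\<lambda>t. index (v t)) ` (?X \<inter> {..<N}))"
      by (subst sum.reindex) (auto intro: inj_on_subset[OF inj])
    also have "\<dots> \<le> (\<Sum>i. (1/2) ^ i)"
      by (rule sum_le_suminf) (auto intro: summable_geometric)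
    finally show "(\<Sum>t<N. ?g t) \<le> (\<Sum>i. (1/2) ^ i)" .
  qed
qed

theorem theorem7p2:
  fixes c :: "nat set \<Rightarrow> nat \<Rightarrow> nat \<Rightarrow> rat option"
  assumes "cost_functional c"
    and "total_functional c"
    and "nondecreasing_in_stage c"
    and "limit_condition c"
  shows "\<exists>D. ce D \<and> \<not> halting_problem \<le>\<^sub>T D \<and> obeys D halting_problem (cost_at c D)"
proof -
  from assms(1) obtain p where p: "\<And>Z x t q. c Z x t = Some q \<longleftrightarrow>
      (\<exists>n. computes Z p (prod_encode (x, t)) n \<and> q = rat_of_code n)"
    unfolding cost_functional_def by blast
  let ?D = "removed p"
  have f: "\<exists>n. computes ?D p (prod_encode (x, t)) n \<and> cost_at c ?D x t = rat_of_code n" for x t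
  proof -
    have "c ?D x t \<noteq> None" using assms(2) by (simp add: total_functional_def)
    then have "c ?D x t = Some (cost_at c ?D x t)" by (simp add: cost_at_def)
    with p show ?thesis by simp
  qed
  have total: "\<exists>n. computes ?D p m n" for m
    using f by (metis prod_decode_inverse surj_pair)
  have "\<exists>P. \<forall>m n. P \<le> fst (prod_decode m) \<longrightarrow> computes ?D p m n \<longrightarrow> small i n" for i
  proof -
    let ?l = "\<lambda>x. liminf (\<lambda>s. ereal (real_of_rat (cost_at c ?D x s)))"
    have "?l \<longlonglongrightarrow> 0" using assms(4) by (simp add: limit_condition_def)
    then have "\<forall>\<^sub>F x in sequentially. ?l x < ereal ((1/2) ^ i)"
      by (rule order_tendstoD) simp
    then obtain P where P: "\<And>x. x \<ge> P \<Longrightarrow> ?l x < ereal ((1/2) ^ i)"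
      unfolding eventually_sequentially by blast
    have "small i n" if "P \<le> fst (prod_decode m)" "computes ?D p m n" for m n
    proof -
      obtain x t where m: "m = prod_encode (x, t)" by (metis prod_decode_inverse surj_pair)
      obtain n' where n': "computes ?D p m n'" "cost_at c ?D x t = rat_of_code n'"
        using f[of x t] m by blast
      have cost: "cost_at c ?D x t = rat_of_code n"
        using n'(2) computes_det[OF n'(1) that(2)] by simp
      \<comment> \<open>By monotonicity in the stage each value is a lower bound for all later ones,
        hence also for their lower limit.\<close>
      have "cost_at c ?D x t \<le> cost_at c ?D x s" if "t \<le> s" for s
        using lift_Suc_mono_le[of "cost_at c ?D x", OF _ that] assms(3)
        by (simp add: nondecreasing_in_stage_def)
      then have "ereal (real_of_rat (cost_at c ?D x t)) \<le> ?l x"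
        by (intro Liminf_bounded) (auto simp: eventually_sequentially of_rat_less_eq)
      also have "\<dots> < ereal ((1/2) ^ i)" using P that(1) m by simp
      finally show ?thesis by (simp add: cost small_iff)
    qed
    then show ?thesis by blast
  qed
  then have "\<not> halting_problem \<le>\<^sub>T ?D" by (rule removed_incomplete)
  moreover have "obeys ?D halting_problem (cost_at c ?D)"
    unfolding obeys_def using approximation_approx[OF total] summable_stage_cost[OF total f] by blast
  ultimately show ?thesis using ce_removed by blast
qed

end
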